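(* Choosing $c=1-2^{-1/2}$, the algorithm described below for sampling a uniform dissection $\mathsf{D}_n$ from $\mathcal{D}_n$ has expected runtime $O(n)$.
   Context: Work in the RAM model of computation. $\mathcal{D}_n$ is the set of dissections of the convex polygon with $n+1$ sides (sides together with non-crossing diagonals), and $\mathsf{D}_n$ is uniform on $\mathcal{D}_n$. There is a bijection $\Phi$ between $\mathcal{D}_n$ and rooted plane trees with $n$ leaves in which no vertex has outdegree $1$ (dual-tree construction). For $c\in(0,1/2)$ let $\zeta$ have distribution $\mathbb{P}(\zeta=0)=\frac{1-2c}{1-c}$, $\mathbb{P}(\zeta=1)=0$, $\mathbb{P}(\zeta=k)=c^{k-1}$ for $k\ge2$; the Bienaymé–Galton–Watson tree $\mathsf{A}_n$ with offspring distribution $\zeta$ conditioned on having exactly $n$ leaves has the same law as $\Phi(\mathsf{D}_n)$. The algorithm: (1) generate $\mathsf{A}_n$ by the paper's general sampler for BGW trees conditioned on the number of vertices with outdegree in $\Omega=\{0\}$ (which runs in expected time $O(n)$ whenever $\mathbb{P}(\zeta=0)>0$, $\mathbb{P}(\zeta\ge2)>0$, $\mathbb{E}[\zeta]=1$, $\mathbb{E}[(1+\epsilon)^\zeta]<\infty$ for some $\epsilon>0$, and $\mathbb{P}(\zeta=k)$ is computable in $e^{o(k)}$ steps); (2) translate the breadth-first outdegree sequence $(d_1,\dots,d_K)$ of $\mathsf{A}_n$ into the dissection $\Phi^{-1}(\mathsf{A}_n)$ by starting with a directed cycle on $d_1+1$ vertices and, for each $i\ge2$ with $d_i>0$, gluing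 a directed cycle of size $d_i+1$ onto the $i$-th edge of the current edge sequence. *)

theory Defs
  imports "HOL-Probability.Probability" "HOL-Library.Landau_Symbols"
begin

section \<open>Randomised random access machine\<close>

text \<open>
  Unit-cost RAM with exact real arithmetic, as is customary for algorithms that generate
  random variates: finitely many named registers (those occurring in the program) and an
  unbounded indirectly addressable memory, all cells holding real numbers; arithmetic,
  comparisons, memory accesses and the generation of a uniform variate from \<open>[0,1]\<close> take one
  step each. The only constants are integers. Control flow is structured instead of by jumps, so
  that programs can be composed.
\<close>

datatype arith_op = Add | Sub | Mul | Div

datatype com =
    Skip
  | SetConst nat int              (* R[i] := z *)
  | Move nat nat                  (* R[i] := R[j] *)
  | Arith arith_op nat nat nat    (* R[i] := R[j] op R[k] *)
  | Sqrt nat nat                  (* R[i] := sqrt R[j] *)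
  | Floor nat nat                 (* R[i] := floor R[j] *)
  | Load nat nat                  (* R[i] := M[R[j]] *)
  | Store nat nat                 (* M[R[i]] := R[j] *)
  | Rand nat                      (* R[i] := fresh uniform variate *)
  | Seq com com                   (infixr ";;" 60)
  | IfLess nat nat com com        (* if R[i] < R[j] *)
  | WhileLess nat nat com         (* while R[i] < R[j] *)

text \<open>The component \<open>used\<close> counts the uniform variates consumed so far.\<close>

record ram_state =
  regs :: "nat \<Rightarrow> real"
  mem :: "nat \<Rightarrow> real"
  used :: nat

fun arith_val :: "arith_op \<Rightarrow> real \<Rightarrow> real \<Rightarrow> real" where
  "arith_val Add x y = x + y"
| "arith_val Sub x y = x - y"
| "arith_val Mul x y = x * y"
| "arith_val Div x y = x / y"

definition set_reg :: "nat \<Rightarrow> real \<Rightarrow> ram_state \<Rightarrow> ram_state" where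
  "set_reg i x s = s\<lparr>regs := (regs s)(i := x)\<rparr>"

definition address :: "real \<Rightarrow> nat" where
  "address x = nat \<lfloor>x\<rfloor>"

text \<open>
  One machine step. A configuration consists of the stack of commands still to be executed and
  the state; \<open>\<omega>\<close> is the sequence of uniform variates, so that a run is a deterministic function
  of \<open>\<omega>\<close>. Configurations with an empty stack are the halted ones.
\<close>

fun step :: "(nat \<Rightarrow> real) \<Rightarrow> com list \<times> ram_state \<Rightarrow> com list \<times> ram_state" where
  "step \<omega> ([], s) = ([], s)"
| "step \<omega> (Skip # cs, s) = (cs, s)"
| "step \<omega> (SetConst i z # cs, s) = (cs, set_reg i (of_int z) s)"
| "step \<omega> (Move i j # cs, s) = (cs, set_reg i (regs s j) s)"
| "step \<omega> (Arith f i j k # cs, s) = (cs, set_reg i (arith_val f (regs s j) (regs s k)) s)"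
| "step \<omega> (Sqrt i j # cs, s) = (cs, set_reg i (sqrt (regs s j)) s)"
| "step \<omega> (Floor i j # cs, s) = (cs, set_reg i (of_int \<lfloor>regs s j\<rfloor>) s)"
| "step \<omega> (Load i j # cs, s) = (cs, set_reg i (mem s (address (regs s j))) s)"
| "step \<omega> (Store i j # cs, s) = (cs, s\<lparr>mem := (mem s)(address (regs s i) := regs s j)\<rparr>)"
| "step \<omega> (Rand i # cs, s) = (cs, set_reg i (\<omega> (used s)) (s\<lparr>used := Suc (used s)\<rparr>))"
| "step \<omega> (Seq a b # cs, s) = (a # b # cs, s)"
| "step \<omega> (IfLess i j a b # cs, s) = ((if regs s i < regs s j then a else b) # cs, s)"
| "step \<omega> (WhileLess i j a # cs, s) =
     (if regs s i < regs s j then a # WhileLess i j a # cs else cs, s)"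

definition uniforms :: "(nat \<Rightarrow> real) measure" where
  "uniforms = (\<Pi>\<^sub>M i\<in>(UNIV :: nat set). uniform_measure lborel {0..1})"

definition input :: "nat \<Rightarrow> ram_state" where
  "input n = \<lparr>regs = (\<lambda>_. 0)(0 := real n), mem = (\<lambda>_. 0), used = 0\<rparr>"

definition returns_within :: "(nat \<Rightarrow> real) \<Rightarrow> com \<Rightarrow> ram_state \<Rightarrow> nat \<Rightarrow> ram_state \<Rightarrow> bool" where
  "returns_within \<omega> p s t s' \<longleftrightarrow> (step \<omega> ^^ t) ([p], s) = ([], s')"

definition returns :: "(nat \<Rightarrow> real) \<Rightarrow> com \<Rightarrow> ram_state \<Rightarrow> ram_state \<Rightarrow> bool" where
  "returns \<omega> p s s' \<longleftrightarrow> (\<exists>t. returns_within \<omega> p s t s')"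

text \<open>Number of steps until the machine halts; \<open>\<infinity>\<close> if it does not halt.\<close>

definition runtime :: "(nat \<Rightarrow> real) \<Rightarrow> com \<Rightarrow> ram_state \<Rightarrow> ennreal" where
  "runtime \<omega> p s = (INF t\<in>{t. \<exists>s'. returns_within \<omega> p s t s'}. of_nat t)"

definition expected_runtime :: "com \<Rightarrow> nat \<Rightarrow> ennreal" where
  "expected_runtime p n = (\<integral>\<^sup>+ \<omega>. runtime \<omega> p (input n) \<partial>uniforms)"

text \<open>Expected runtime \<open>O(n)\<close>, as \<open>n\<close> tends to infinity within \<open>A\<close>.\<close>

definition expected_linear_time_on :: "nat set \<Rightarrow> com \<Rightarrow> bool" where
  "expected_linear_time_on A p \<longleftrightarrow>
     (let F = inf sequentially (principal A) in
       (\<forall>\<^sub>F n in F. expected_runtime p n < \<infinity>) \<and>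
       (\<lambda>n. enn2real (expected_runtime p n)) \<in> O[F](\<lambda>n. real n))"

text \<open>The point probabilities \<open>P(\<xi> = k)\<close> can be computed in \<open>exp(o(k))\<close> steps.\<close>

definition subexp_computable :: "nat pmf \<Rightarrow> bool" where
  "subexp_computable \<xi> \<longleftrightarrow>
     (\<exists>p f. f \<in> o(\<lambda>k. real k) \<and>
       (\<forall>\<omega> k. \<exists>t s'. real t \<le> exp (f k) \<and> returns_within \<omega> p (input k) t s' \<and>
                      regs s' 0 = pmf \<xi> k))"

text \<open>Arrays are handed over by length in register 0 and base address in register 1.\<close>

definition stores_list :: "ram_state \<Rightarrow> nat list \<Rightarrow> bool" where
  "stores_list s xs \<longleftrightarrow>
     regs s 0 = real (length xs) \<and>
     (\<exists>b. regs s 1 = real b \<and> (\<forall>i<length xs. mem s (b + i) = real (xs ! i)))"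

definition stores_edges :: "ram_state \<Rightarrow> (nat \<times> nat) list \<Rightarrow> bool" where
  "stores_edges s es \<longleftrightarrow>
     regs s 0 = real (length es) \<and>
     (\<exists>b. regs s 1 = real b \<and>
       (\<forall>i<length es. mem s (b + 2 * i) = real (fst (es ! i)) \<and>
                      mem s (b + 2 * i + 1) = real (snd (es ! i))))"


section \<open>Conditioned Bienayme-Galton-Watson trees\<close>

datatype plane_tree = Branch "plane_tree list"

fun num_leaves :: "plane_tree \<Rightarrow> nat" where
  "num_leaves (Branch ts) = (if ts = [] then 1 else sum_list (map num_leaves ts))"

text \<open>Breadth-first outdegree sequence; the argument of \<open>bfs_queue\<close> is the queue.\<close>

function bfs_queue :: "plane_tree list \<Rightarrow> nat list" where
  "bfs_queue [] = []"
| "bfs_queue (Branch ts # q) = length ts # bfs_queue (q @ ts)"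
  by pat_completeness auto
termination
proof (relation "Wellfounded.measure (\<lambda>q. sum_list (map size q))")
  fix ts q
  have "sum_list (map size ts) \<le> size_list size (ts :: plane_tree list)"
    by (induction ts) auto
  then show "(q @ ts, Branch ts # q) \<in> Wellfounded.measure (\<lambda>q. sum_list (map size q))"
    by simp
qed simp

definition bfs :: "plane_tree \<Rightarrow> nat list" where
  "bfs t = bfs_queue [t]"

text \<open>Probability that the BGW tree with offspring distribution \<open>\<xi>\<close> equals the finite tree \<open>t\<close>.\<close>

fun bgw :: "nat pmf \<Rightarrow> plane_tree \<Rightarrow> real" where
  "bgw \<xi> (Branch ts) = pmf \<xi> (length ts) * prod_list (map (bgw \<xi>) ts)"

text \<open>
  Probability that the BGW tree has exactly \<open>n\<close> leaves. For the critical, non-degenerate offspring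
  distributions considered below the tree is almost surely finite.
\<close>

definition bgw_leaves :: "nat pmf \<Rightarrow> nat \<Rightarrow> real" where
  "bgw_leaves \<xi> n = infsum (bgw \<xi>) {t. num_leaves t = n}"

text \<open>On input \<open>n\<close>, \<open>p\<close> returns the BGW tree conditioned on having \<open>n\<close> leaves.\<close>

definition samples_conditioned_bgw :: "nat pmf \<Rightarrow> com \<Rightarrow> bool" where
  "samples_conditioned_bgw \<xi> p \<longleftrightarrow>
     (\<forall>n t. bgw_leaves \<xi> n > 0 \<and> num_leaves t = n \<longrightarrow>
       \<P>(\<omega> in uniforms. \<exists>s. returns \<omega> p (input n) s \<and> stores_list s (bfs t))
         = bgw \<xi> t / bgw_leaves \<xi> n)"


section \<open>Dissections\<close>

text \<open>
  The polygon with \<open>n + 1\<close> sides has vertices \<open>0, \<dots>, n\<close> in cyclic order; a segment is a pair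
  \<open>(a, b)\<close> with \<open>a < b\<close>.
\<close>

definition polygon_sides :: "nat \<Rightarrow> (nat \<times> nat) set" where
  "polygon_sides n = insert (0, n) {(k, Suc k) | k. k < n}"

definition polygon_diagonals :: "nat \<Rightarrow> (nat \<times> nat) set" where
  "polygon_diagonals n = {(a, b). a < b \<and> b \<le> n} - polygon_sides n"

definition crossing :: "nat \<times> nat \<Rightarrow> nat \<times> nat \<Rightarrow> bool" where
  "crossing e f \<longleftrightarrow>
     fst e < fst f \<and> fst f < snd e \<and> snd e < snd f \<or>
     fst f < fst e \<and> fst e < snd f \<and> snd f < snd e"

definition dissections :: "nat \<Rightarrow> (nat \<times> nat) set set" where
  "dissections n = {polygon_sides n \<union> S | S.
     S \<subseteq> polygon_diagonals n \<and> (\<forall>e\<in>S. \<forall>f\<in>S. \<not> crossing e f)}"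

text \<open>
  The translation produces an edge sequence over vertex names in order of creation. It describes
  the dissection \<open>D\<close> if naming the polygon vertices appropriately turns it into a duplicate-free
  list of the segments of \<open>D\<close>: the first edge becomes the root side, directed from \<open>n\<close> to \<open>0\<close>,
  and every other edge becomes a segment directed from its smaller to its larger end.
\<close>

definition describes_dissection :: "(nat \<times> nat) list \<Rightarrow> nat \<Rightarrow> (nat \<times> nat) set \<Rightarrow> bool" where
  "describes_dissection es n D \<longleftrightarrow>
     es \<noteq> [] \<and> distinct es \<and>
     (\<exists>r. bij_betw r (fst ` set es \<union> snd ` set es) {0..n} \<and>
          map_prod r r (hd es) = (n, 0) \<and>
          map_prod r r ` set (tl es) = D - {(0, n)})"

definition samples_uniform_dissection :: "com \<Rightarrow> bool" where
  "samples_uniform_dissection p \<longleftrightarrow>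
     (\<forall>n\<ge>2. \<forall>D\<in>dissections n.
       \<P>(\<omega> in uniforms. \<exists>s es. returns \<omega> p (input n) s \<and> stores_edges s es \<and>
                              describes_dissection es n D)
         = 1 / real (card (dissections n)))"


section \<open>The sampling algorithm\<close>

definition zeta :: "real \<Rightarrow> nat pmf" where
  "zeta c = embed_pmf (\<lambda>k. if k = 0 then (1 - 2 * c) / (1 - c) else if k = 1 then 0 else c ^ (k - 1))"

text \<open>
  Translation of the outdegree sequence \<open>(d\<^sub>1, \<dots>, d\<^sub>K)\<close> with register 0 containing \<open>K\<close> and register
  1 its base address. The edge sequence is written behind it, from the address in register 2 on.

  The initial directed cycle is \<open>0 \<rightarrow> 1 \<rightarrow> \<dots> \<rightarrow> d\<^sub>1 \<rightarrow> 0\<close> with first edge \<open>(d\<^sub>1, 0)\<close>.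
  Faces carry the same orientation, so a common edge is traversed in opposite directions by the
  two faces: gluing a directed cycle of size \<open>d + 1\<close> onto \<open>(u, w)\<close> identifies one of its edges with
  \<open>(w, u)\<close>, and the remaining ones form a directed path of length \<open>d\<close> from \<open>u\<close> to \<open>w\<close> through
  \<open>d - 1\<close> new vertices. They are appended to the edge sequence in this order. The edge onto which
  a cycle is glued and the outdegree \<open>d\<^sub>i\<close> have the same index \<open>i\<close>.
\<close>

abbreviation (input) "r_len \<equiv> 0 :: nat"
abbreviation (input) "r_base \<equiv> 1 :: nat"
abbreviation (input) "r_edges \<equiv> 2 :: nat"
abbreviation (input) "r_zero \<equiv> 3 :: nat"
abbreviation (input) "r_one \<equiv> 4 :: nat"
abbreviation (input) "r_end \<equiv> 5 :: nat"      (* address behind the current edge sequence *)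
abbreviation (input) "r_new \<equiv> 6 :: nat"      (* next unused vertex name *)
abbreviation (input) "r_i \<equiv> 7 :: nat"
abbreviation (input) "r_j \<equiv> 8 :: nat"
abbreviation (input) "r_d \<equiv> 9 :: nat"
abbreviation (input) "r_u \<equiv> 10 :: nat"
abbreviation (input) "r_w \<equiv> 11 :: nat"
abbreviation (input) "r_addr \<equiv> 12 :: nat"

definition append_edge :: "nat \<Rightarrow> nat \<Rightarrow> com" where
  "append_edge i j =
     Store r_end i ;; Arith Add r_end r_end r_one ;;
     Store r_end j ;; Arith Add r_end r_end r_one"

definition start_cycle :: com where
  "start_cycle =
     Load r_d r_base ;;
     append_edge r_d r_zero ;;
     Move r_new r_zero ;;
     WhileLess r_new r_d (
       Arith Add r_u r_new r_one ;;
       append_edge r_new r_u ;;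
       Move r_new r_u) ;;
     Arith Add r_new r_new r_one"

definition glue_cycle :: com where
  "glue_cycle =
     Arith Add r_addr r_i r_i ;; Arith Add r_addr r_edges r_addr ;; Load r_u r_addr ;;
     Arith Add r_addr r_addr r_one ;; Load r_w r_addr ;;
     Move r_j r_one ;;
     WhileLess r_j r_d (
       append_edge r_u r_new ;;
       Move r_u r_new ;;
       Arith Add r_new r_new r_one ;;
       Arith Add r_j r_j r_one) ;;
     append_edge r_u r_w"

definition translate :: com where
  "translate =
     SetConst r_zero 0 ;; SetConst r_one 1 ;;
     Arith Add r_edges r_base r_len ;; Move r_end r_edges ;;
     start_cycle ;;
     Move r_i r_one ;;
     WhileLess r_i r_len (
       Arith Add r_addr r_base r_i ;; Load r_d r_addr ;;
       IfLess r_zero r_d glue_cycle Skip ;;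
       Arith Add r_i r_i r_one) ;;
     Move r_base r_edges"

definition dissection_sampler :: "(nat pmf \<Rightarrow> com) \<Rightarrow> real \<Rightarrow> com" where
  "dissection_sampler bgw_sampler c = bgw_sampler (zeta c) ;; translate"

end

theory Submission
  imports Defs
begin

text \<open>
  For \<open>c = 1 - 2 powr (-1/2)\<close> the offspring distribution is critical with exponential moments and its
  point probabilities are computed in linear time, so the tree sampler applies. A tree with \<open>n\<close> leaves
  and no unary vertex has weight \<open>p\<^sub>0^n * c^(n - 1)\<close>, whatever its shape, and all other trees have
  weight \<open>0\<close>; hence the sampled tree is uniform. Number the gaps between leaves by \<open>0, \<dots>, n\<close> and send
  a vertex to the segment \<open>(a, b)\<close> delimiting the leaves below it. The segments of a tree form a
  dissection, which determines the tree, and every dissection arises. Gluing cycles in breadth-first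
  order produces exactly these segments up to names of the polygon vertices; the names are forced, because
  the edges at the leaves form a path through all vertices. Such a tree has at most \<open>2 * n - 1\<close>
  vertices, so the translation adds \<open>O(n)\<close> steps on a set of probability \<open>1\<close>.
\<close>

section \<open>Program verification\<close>

text \<open>Two orders have to be reconciled. The translation creates edges and vertex names
  breadth-first, whereas polygon positions run from left to right along the leaves. So the renaming
  is not given in advance but extended at each gluing, and the edges are compared with the preorder
  list of segments as multisets. The tree sampler is opaque: only the probabilities of its tree
  events and its expected runtime are known. That it almost surely outputs a tree without unary
  vertices is derived afterwards, because the equal probabilities of the finitely many such trees
  add up to 1. The behaviour of the translation on any other output then never matters. The weight
  of a tree is independent of its shape because the outdegrees of the inner vertices, each
  diminished by 1, add up to \<open>n - 1\<close>. The bound on the number of vertices comes from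
  every inner vertex having at least two children.\<close>

text \<open>The postcondition also receives the number of steps taken.\<close>

definition wp :: "(nat \<Rightarrow> real) \<Rightarrow> com \<Rightarrow> (nat \<Rightarrow> ram_state \<Rightarrow> bool) \<Rightarrow> ram_state \<Rightarrow> bool" where
  "wp \<omega> c Q s \<longleftrightarrow> (\<exists>t s'. (\<forall>cs. (step \<omega> ^^ t) (c # cs, s) = (cs, s')) \<and> Q t s')"

lemma wp_step:
  assumes "\<And>cs. step \<omega> (c # cs, s) = (cs, s')" and "Q 1 s'"
  shows "wp \<omega> c Q s"
  unfolding wp_def using assms by (intro exI[of _ 1] exI[of _ s']) auto

text \<open>\<open>wp\<close> quantifies over the rest of the stack, so the run of \<open>a\<close>
  may be taken with \<open>b\<close> waiting beneath it. The extra step unfolds the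
  sequence.\<close>

lemma wp_Seq:
  assumes "wp \<omega> a (\<lambda>t1. wp \<omega> b (\<lambda>t2. Q (1 + t1 + t2))) s"
  shows "wp \<omega> (a ;; b) Q s"
proof -
  obtain t1 s1 t2 s2
    where 1: "\<And>cs. (step \<omega> ^^ t1) (a # cs, s) = (cs, s1)"
      and 2: "\<And>cs. (step \<omega> ^^ t2) (b # cs, s1) = (cs, s2)" and Q: "Q (1 + t1 + t2) s2"
    using assms unfolding wp_def by blast
  have "(step \<omega> ^^ (t2 + t1 + 1)) ((a ;; b) # cs, s) = (cs, s2)" for cs
    using 1 2 by (simp only: funpow_add o_apply One_nat_def funpow.simps step.simps id_apply)
  then show ?thesis
    unfolding wp_def using Q by (intro exI[of _ "t2 + t1 + 1"] exI[of _ s2]) (simp add: ac_simps)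
qed

lemma wp_Suc:
  assumes "\<And>cs. step \<omega> (c # cs, s) = (c' # cs, s)" and "wp \<omega> c' (\<lambda>t. Q (Suc t)) s"
  shows "wp \<omega> c Q s"
proof -
  obtain t s' where "\<And>cs. (step \<omega> ^^ t) (c' # cs, s) = (cs, s')" "Q (Suc t) s'"
    using assms(2) unfolding wp_def by blast
  then show ?thesis
    unfolding wp_def using assms(1)
    by (intro exI[of _ "Suc t"] exI[of _ s']) (simp add: funpow_Suc_right del: funpow.simps)
qed

lemma wp_IfLess:
  assumes "regs s i < regs s j \<Longrightarrow> wp \<omega> a (\<lambda>t. Q (Suc t)) s"
    and "\<not> regs s i < regs s j \<Longrightarrow> wp \<omega> b (\<lambda>t. Q (Suc t)) s"
  shows "wp \<omega> (IfLess i j a b) Q s"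
  by (cases "regs s i < regs s j"; rule wp_Suc) (use assms in auto)

text \<open>The invariant carries a counter \<open>k\<close> and the time \<open>t\<close> spent so
  far. As the loop ends exactly at \<open>k = N\<close>, termination needs no separate
  argument.\<close>

lemma wp_WhileLess:
  assumes step: "\<And>k t s. I k t s \<Longrightarrow> k < N \<Longrightarrow>
      regs s i < regs s j \<and> wp \<omega> c (\<lambda>t'. I (Suc k) (t + 1 + t')) s"
    and exit: "\<And>t s. I N t s \<Longrightarrow> \<not> regs s i < regs s j \<and> Q (t + 1) s"
    and init: "I k 0 s" and "k \<le> N"
  shows "wp \<omega> (WhileLess i j c) Q s"
proof -
  \<comment> \<open>Generalised to a loop with time \<open>t\<close> already spent; the induction
    runs downwards from \<open>N\<close>.\<close>
  have "wp \<omega> (WhileLess i j c) (\<lambda>t'. Q (t + t')) s" if "k \<le> N" "I k t s" for k t s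
    using that
  proof (induction k arbitrary: t s rule: inc_induct)
    case base
    with exit[of t s] show ?case
      by (intro wp_step[where s' = s]) auto
  next
    case (step k)
    from assms(1)[OF step.prems step.hyps(2)] obtain t1 s1 where
      less: "regs s i < regs s j" and
      1: "\<And>cs. (step \<omega> ^^ t1) (c # cs, s) = (cs, s1)" and I: "I (Suc k) (t + 1 + t1) s1"
      unfolding wp_def by blast
    from step.IH[OF I] obtain t2 s2 where
      2: "\<And>cs. (step \<omega> ^^ t2) (WhileLess i j c # cs, s1) = (cs, s2)" and Q: "Q (t + 1 + t1 + t2) s2"
      unfolding wp_def by blast
    have "(step \<omega> ^^ (t2 + t1 + 1)) (WhileLess i j c # cs, s) = (cs, s2)" for cs
      using 1 2 less by (simp only: funpow_add o_apply One_nat_def funpow.simps step.simps id_apply if_True)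
    then show ?case
      unfolding wp_def using Q by (intro exI[of _ "t2 + t1 + 1"] exI[of _ s2]) (simp add: ac_simps)
  qed
  from this[of k 0 s] show ?thesis using assms by simp
qed

text \<open>The new part of a glued cycle. Only its last edge ends in an old vertex, hence the
  separate equation for length 1; length 0 lets leaves pass through \<open>glue\<close> without a
  case distinction.\<close>

fun face_path :: "nat \<Rightarrow> nat \<Rightarrow> nat \<Rightarrow> nat \<Rightarrow> (nat \<times> nat) list" where
  "face_path u w 0 v = []"
| "face_path u w (Suc 0) v = [(u, w)]"
| "face_path u w (Suc (Suc d)) v = (u, v) # face_path v w (Suc d) (Suc v)"

text \<open>
  \<open>glue ds q v\<close> consumes the queue \<open>q\<close> of edges onto which no cycle has been glued yet, in step with
  the outdegrees \<open>ds\<close>; \<open>v\<close> is the next unused vertex name. An edge is output when it leaves the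
  queue, so that the output is in order of creation.
\<close>

fun glue :: "nat list \<Rightarrow> (nat \<times> nat) list \<Rightarrow> nat \<Rightarrow> (nat \<times> nat) list" where
  "glue (d # ds) ((u, w) # q) v = (u, w) # glue ds (q @ face_path u w d v) (v + (d - 1))"
| "glue _ _ _ = []"

text \<open>The initial cycle consumes the first outdegree, so its edge \<open>(d, 0)\<close> is
  output before the queue starts. This keeps edges and outdegrees aligned by index.\<close>

fun edge_sequence :: "nat list \<Rightarrow> (nat \<times> nat) list" where
  "edge_sequence [] = []"
| "edge_sequence (d # ds) = (d, 0) # glue ds (face_path 0 d d 1) (Suc d)"

section \<open>Correctness and running time of the translation\<close>

lemma length_face_path [simp]: "length (face_path u w d v) = d"
  by (induction u w d v rule: face_path.induct) auto

text \<open>The edges lie directly behind the outdegrees, so appending one overwrites nothing that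
  is still to be read. Only registers up to 5 occur, which leaves the working registers free to
  change.\<close>

definition layout :: "nat list \<Rightarrow> nat \<Rightarrow> (nat \<times> nat) list \<Rightarrow> ram_state \<Rightarrow> bool" where
  "layout ds b es s \<longleftrightarrow>
     regs s r_len = real (length ds) \<and> regs s r_base = real b \<and>
     regs s r_edges = real (b + length ds) \<and> regs s r_zero = 0 \<and> regs s r_one = 1 \<and>
     regs s r_end = real (b + length ds + 2 * length es) \<and>
     (\<forall>i<length ds. mem s (b + i) = real (ds ! i)) \<and>
     (\<forall>i<length es. mem s (b + length ds + 2 * i) = real (fst (es ! i)) \<and>
                    mem s (b + length ds + 2 * i + 1) = real (snd (es ! i)))"

lemma address_of_nat [simp]: "address (real n) = n"
  by (simp add: address_def)

lemma regs_set_reg [simp]: "regs (set_reg i x s) = (regs s)(i := x)"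
  and mem_set_reg [simp]: "mem (set_reg i x s) = mem s"
  by (simp_all add: set_reg_def)

lemma layout_set_reg [simp]: "i > 5 \<Longrightarrow> layout ds b es (set_reg i x s) = layout ds b es s"
  by (simp add: layout_def)

lemma wp_SetConst: "Q 1 (set_reg i (of_int z) s) \<Longrightarrow> wp \<omega> (SetConst i z) Q s"
  and wp_Move: "Q 1 (set_reg i (regs s j) s) \<Longrightarrow> wp \<omega> (Move i j) Q s"
  and wp_Arith: "Q 1 (set_reg i (arith_val f (regs s j) (regs s k)) s) \<Longrightarrow> wp \<omega> (Arith f i j k) Q s"
  and wp_Sqrt: "Q 1 (set_reg i (sqrt (regs s j)) s) \<Longrightarrow> wp \<omega> (Sqrt i j) Q s"
  and wp_Load: "Q 1 (set_reg i (mem s (address (regs s j))) s) \<Longrightarrow> wp \<omega> (Load i j) Q s"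
  and wp_Store: "Q 1 (s\<lparr>mem := (mem s)(address (regs s i) := regs s j)\<rparr>) \<Longrightarrow> wp \<omega> (Store i j) Q s"
  and wp_Skip: "Q 1 s \<Longrightarrow> wp \<omega> Skip Q s"
  by (rule wp_step[rotated], assumption, simp)+

lemmas wp_intros = wp_Seq wp_SetConst wp_Move wp_Arith wp_Sqrt wp_Load wp_Store wp_Skip

text \<open>Seven steps are four commands and three sequencing steps. Register 5 is the write
  pointer.\<close>

lemma wp_append_edge:
  assumes layout: "layout ds b es s" and uw: "regs s i = real u" "regs s j = real w" "i \<noteq> 5" "j \<noteq> 5"
    and Q: "\<And>s'. layout ds b (es @ [(u, w)]) s' \<Longrightarrow> (\<And>k. k \<noteq> 5 \<Longrightarrow> regs s' k = regs s k) \<Longrightarrow> Q 7 s'"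
  shows "wp \<omega> (append_edge i j) Q s"
proof -
  let ?e = "b + length ds + 2 * length es"
  have r: "regs s 5 = real ?e" "regs s 4 = 1" using layout by (auto simp: layout_def)
  have 1: "address (real ?e + 1) = ?e + 1"
    using address_of_nat[of "?e + 1"] by (simp add: add.commute del: address_of_nat)
  have 2: "t = 7 \<Longrightarrow> layout ds b (es @ [(u, w)]) s' \<Longrightarrow> (\<And>k. k \<noteq> 5 \<Longrightarrow> regs s' k = regs s k) \<Longrightarrow> Q t s'" for t s'
    using Q by blast
  show ?thesis
    unfolding append_edge_def
    apply (rule wp_intros)+
    apply (rule 2)
    subgoal by simp
    subgoal
      using layout 1 uw unfolding layout_def
      by (auto simp: nth_append less_Suc_eq address_of_nat simp del: of_nat_add of_nat_mult)
    subgoal by simp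
    done
qed

lemma wp_glue_cycle:
  assumes layout: "layout ds b es s" and i: "i < length es" "es ! i = (u, w)"
    and r: "regs s r_i = real i" "regs s r_new = real v" "regs s r_d = real d" "d > 0"
    and Q: "\<And>t s'. t \<le> 40 * d \<Longrightarrow> layout ds b (es @ face_path u w d v) s' \<Longrightarrow>
      regs s' r_new = real (v + (d - 1)) \<Longrightarrow> regs s' r_i = real i \<Longrightarrow> Q t s'"
  shows "wp \<omega> glue_cycle Q s"
proof -
  \<comment> \<open>The counter \<open>k\<close> is the content of \<open>r_j\<close>, which starts
    at 1; each round takes 14 steps. The edges written so far followed by the path still to be
    written are always the final list. At \<open>k = d\<close> a single edge to \<open>w\<close> is
    left, which is written after the loop.\<close>
  define I where "I k t s' \<longleftrightarrow> t + 14 \<le> 14 * k \<and> k \<le> d \<and>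
     regs s' r_i = real i \<and> regs s' r_d = real d \<and> regs s' r_w = real w \<and> regs s' r_j = real k \<and>
     (\<exists>es' u'. layout ds b es' s' \<and> regs s' r_u = real u' \<and> regs s' r_new = real (v + (k - 1)) \<and> k > 0 \<and>
        es' @ face_path u' w (d + 1 - k) (v + (k - 1)) = es @ face_path u w d v)" for k t s'
  have mem: "mem s (b + length ds + 2 * i) = real u" "mem s (Suc (b + length ds + 2 * i)) = real w"
    "regs s 0 = real (length ds)" "regs s 2 = real (b + length ds)" "regs s 4 = 1"
    using layout i unfolding layout_def by auto
  have addr: "address (real b + real (length ds) + (real i + real i)) = b + length ds + 2 * i"
    "address (real b + real (length ds) + (real i + real i) + 1) = Suc (b + length ds + 2 * i)"
    using address_of_nat[of "b + length ds + 2 * i"] address_of_nat[of "Suc (b + length ds + 2 * i)"]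
    by (simp_all add: ac_simps del: address_of_nat)
  show ?thesis
    unfolding glue_cycle_def
    apply (rule wp_intros)+
    apply (rule wp_WhileLess[where I = I and k = 1 and N = d])
    subgoal premises prems for k t s'
    proof -
      from prems obtain es' u' where *: "t + 14 \<le> 14 * k" "k < d" "k > 0" "layout ds b es' s'"
        "regs s' r_u = real u'" "regs s' r_new = real (v + (k - 1))"
        "es' @ face_path u' w (d + 1 - k) (v + (k - 1)) = es @ face_path u w d v"
        and rs: "regs s' r_i = real i" "regs s' r_d = real d" "regs s' r_w = real w" "regs s' r_j = real k"
        unfolding I_def by auto
      have one: "regs s' 4 = 1" using *(4) by (simp add: layout_def)
      obtain m where m: "d + 1 - k = Suc (Suc m)" "d - k = Suc m"
        using \<open>k < d\<close> by (metis Suc_diff_Suc Suc_eq_plus1 Suc_diff_le less_imp_le_nat)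
      obtain n where n: "k = Suc n" using \<open>k > 0\<close> gr0_implies_Suc by blast
      show ?thesis
        apply (intro conjI)
        subgoal using rs * by simp
        apply (rule wp_intros)+
        apply (rule wp_append_edge[OF *(4,5,6)])
        apply simp
        apply simp
        apply (rule wp_intros)+
        subgoal for s1
          unfolding I_def using * rs m one unfolding n
          apply simp
          apply (intro exI[of _ "es' @ [(u', v + n)]"] conjI exI[of _ "v + n"])
          apply simp_all
          done
        done
    qed
    subgoal premises prems for t s'
    proof -
      from prems obtain es' u' where *: "t + 14 \<le> 14 * d" "layout ds b es' s'"
        "regs s' r_u = real u'" "regs s' r_new = real (v + (d - 1))"
        "es' @ [(u', w)] = es @ face_path u w d v"
        and rs: "regs s' r_i = real i" "regs s' r_d = real d" "regs s' r_w = real w" "regs s' r_j = real d"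
        unfolding I_def by auto
      show ?thesis
        apply (intro conjI)
        subgoal using rs by simp
        apply (rule wp_append_edge[OF *(2,3) rs(3)])
        apply simp
        apply simp
        apply (rule Q)
        using * rs \<open>d > 0\<close> by simp_all
    qed
    subgoal
      unfolding I_def using layout r mem addr
      by simp
    subgoal using \<open>d > 0\<close> by simp
    done
qed

lemma wp_start_cycle:
  assumes layout: "layout (d # ds) b [] s"
    and Q: "\<And>t s'. t \<le> 20 * Suc d \<Longrightarrow> layout (d # ds) b ((d, 0) # face_path 0 d d 1) s' \<Longrightarrow>
      regs s' r_new = real (Suc d) \<Longrightarrow> Q t s'"
  shows "wp \<omega> start_cycle Q s"
proof -
  define I where "I k t s' \<longleftrightarrow> t \<le> 13 * k \<and> k \<le> d \<and>
     regs s' r_d = real d \<and> regs s' r_new = real k \<and>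
     (\<exists>es'. layout (d # ds) b es' s' \<and> es' @ face_path k d (d - k) (Suc k) = (d, 0) # face_path 0 d d 1)" for k t s'
  have mem: "mem s (address (regs s 1)) = real d"
    and zero: "regs s 3 = 0"
    using layout by (auto simp: layout_def)
  show ?thesis
    unfolding start_cycle_def
    apply (rule wp_intros)+
    apply (rule wp_append_edge[of "d # ds" b "[]" _ _ d _ 0])
    subgoal using layout by simp
    subgoal using mem by simp
    subgoal using layout by (simp add: layout_def)
    subgoal by simp
    subgoal by simp
    apply (rule wp_intros)+
    subgoal premises prems1 for s1
    apply (rule wp_WhileLess[where I = I and k = 0 and N = d])
    subgoal premises prems for k t s'
    proof -
      from prems obtain es' where *: "t \<le> 13 * k" "k < d" "layout (d # ds) b es' s'"
        "es' @ face_path k d (d - k) (Suc k) = (d, 0) # face_path 0 d d 1"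
        and rs: "regs s' r_new = real k" "regs s' r_d = real d"
        unfolding I_def by auto
      have one: "regs s' 4 = 1" using *(3) by (simp add: layout_def)
      obtain m where m: "d - k = Suc m" "d - Suc k = m"
        using \<open>k < d\<close> by (metis Suc_diff_Suc)
      \<comment> \<open>For \<open>m = 0\<close> the path ends in \<open>d = Suc k\<close>, so the
        loop can treat its last edge like the others.\<close>
      have face_path: "face_path k d (Suc m) (Suc k) = (k, Suc k) # face_path (Suc k) d m (Suc (Suc k))"
        using m by (cases m) auto
      show ?thesis
        apply (intro conjI)
        subgoal using rs * by simp
        apply (rule wp_intros)+
        apply (rule wp_append_edge[of "d # ds" b es' _ _ k _ "Suc k"])
        subgoal using * by simp
        subgoal using rs by simp
        subgoal using rs one by simp
        subgoal by simp
        subgoal by simp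
        apply (rule wp_intros)+
        subgoal for s1
          unfolding I_def using * rs m one face_path
          apply simp
          apply (intro exI[of _ "es' @ [(k, Suc k)]"])
          apply simp
          done
        done
    qed
    subgoal premises prems for t s'
    proof -
      from prems have *: "t \<le> 13 * d" "layout (d # ds) b ((d, 0) # face_path 0 d d 1) s'"
        and rs: "regs s' r_new = real d" "regs s' r_d = real d"
        unfolding I_def by auto
      have one: "regs s' 4 = 1" using *(2) by (simp add: layout_def)
      show ?thesis
        apply (intro conjI)
        subgoal using rs by simp
        apply (rule wp_intros)+
        apply (rule Q)
        using * rs one by simp_all
    qed
    subgoal
      unfolding I_def using layout prems1 mem zero
      by simp
    subgoal by simp
    done
  done
qed

text \<open>Instead of a tree, an equality of lengths is assumed: since \<open>glue\<close> stops at
  an empty queue, it says that an edge is available for every outdegree. The time is charged to the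
  loop rounds and to the edges glued.\<close>

lemma wp_translate:
  assumes s: "stores_list s (d # ds)"
    and len: "length (edge_sequence (d # ds)) = length (d # ds)"
    and Q: "\<And>t s'. t \<le> 100 * (length (d # ds) + sum_list (d # ds)) \<Longrightarrow>
      stores_edges s' (edge_sequence (d # ds)) \<Longrightarrow> Q t s'"
  shows "wp \<omega> translate Q s"
proof -
  let ?ds = "d # ds"
  \<comment> \<open>The memory holds all edges created so far: those in \<open>es\<close> have been
    dealt with, and \<open>q\<close> is the queue of \<open>glue\<close>. As \<open>es\<close> has
    length \<open>k\<close>, the edge read by the program is the head of \<open>q\<close>.\<close>
  define I where "I b k t s' \<longleftrightarrow> t \<le> 50 * (k + sum_list (take k ?ds)) \<and> k \<le> length ?ds \<and>
     regs s' r_i = real k \<and>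
     (\<exists>es q v. length es = k \<and> layout ?ds b (es @ q) s' \<and> regs s' r_new = real v \<and>
        es @ glue (drop k ?ds) q v = edge_sequence ?ds)" for b k t s'
  obtain b where b: "regs s 1 = real b" "\<And>i. i < length ?ds \<Longrightarrow> mem s (b + i) = real (?ds ! i)"
    and len_reg: "regs s 0 = real (length ?ds)"
    using s unfolding stores_list_def by blast
  show ?thesis
    unfolding translate_def
    apply (rule wp_intros)+
    apply (rule wp_start_cycle[of d ds b])
    subgoal using b len_reg by (auto simp: layout_def)
    apply (rule wp_intros)+
    subgoal premises prems1 for t1 s1
    apply (rule wp_WhileLess[where I = "I b" and k = 1 and N = "length ?ds"])
    subgoal premises prems for k t s'
    proof -
      from prems obtain es q v where *: "t \<le> 50 * (k + sum_list (take k ?ds))" "k < length ?ds"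
        "length es = k" "layout ?ds b (es @ q) s'" "regs s' r_new = real v"
        "es @ glue (drop k ?ds) q v = edge_sequence ?ds" and rs: "regs s' r_i = real k"
        unfolding I_def by auto
      have one: "regs s' 4 = 1" "regs s' 3 = 0" "regs s' 1 = real b" "regs s' 0 = real (length ?ds)"
        using *(4) by (simp_all add: layout_def)
      have drop: "drop k ?ds = ?ds ! k # drop (Suc k) ?ds"
        using Cons_nth_drop_Suc[OF \<open>k < length ?ds\<close>] by simp
      \<comment> \<open>An empty queue at this point would cut the output short.\<close>
      have "length (glue (drop k ?ds) q v) = length (drop k ?ds)"
        using arg_cong[OF *(6), of length] *(3) unfolding len length_append length_drop by simp
      then obtain u w q' where q: "q = (u, w) # q'"
        using \<open>k < length ?ds\<close> drop by (cases q) auto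
      have take: "sum_list (take (Suc k) ?ds) = sum_list (take k ?ds) + ?ds ! k"
        using \<open>k < length ?ds\<close> by (simp only: take_Suc_conv_app_nth) simp
      have addr: "address (real b + real k) = b + k"
        using address_of_nat[of "b + k"] by (simp del: address_of_nat)
      have mem: "mem s' (b + k) = real (?ds ! k)"
        using *(2,4) by (simp add: layout_def)
      have glued: "es @ glue (drop k ?ds) q v =
        (es @ [(u, w)]) @ glue (drop (Suc k) ?ds) (q' @ face_path u w (?ds ! k) v) (v + (?ds ! k - 1))"
        unfolding drop q by simp
      have I: "I b (Suc k) t' s2" if "layout ?ds b ((es @ q) @ face_path u w (?ds ! k) v) s2"
        "regs s2 r_new = real (v + (?ds ! k - 1))" "regs s2 r_i = real (Suc k)"
        "t' \<le> 50 * (Suc k + sum_list (take (Suc k) ?ds))" for t' s2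
      proof -
        have "length (es @ [(u, w)]) = Suc k"
          "layout ?ds b ((es @ [(u, w)]) @ (q' @ face_path u w (?ds ! k) v)) s2"
          "(es @ [(u, w)]) @ glue (drop (Suc k) ?ds) (q' @ face_path u w (?ds ! k) v) (v + (?ds ! k - 1))
            = edge_sequence ?ds"
          using that * q glued by simp_all
        with that \<open>k < length ?ds\<close> show ?thesis
          unfolding I_def by (metis Suc_leI)
      qed
      show ?thesis
        apply (intro conjI)
        subgoal using rs * one by simp
        apply (rule wp_intros)+
        apply (rule wp_IfLess)
        subgoal
          apply (rule wp_glue_cycle[of ?ds b "es @ q" _ k u w v "?ds ! k"])
          subgoal using * by simp
          subgoal using * q by simp
          subgoal using * q by (simp add: nth_append)
          subgoal using rs by simp
          subgoal using * by simp
          subgoal using mem one rs addr by simp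
          subgoal using mem one rs addr by (auto split: if_splits)
          apply (rule wp_intros)+
          apply (rule I)
          subgoal by simp
          subgoal by simp
          subgoal using rs one by (simp add: layout_def)
          subgoal using *(1) take by simp
          done
        subgoal premises ps
        proof -
          have 0: "?ds ! k = 0" using ps mem one rs addr by simp
          show ?thesis
            apply (rule wp_intros)+
            apply (rule I)
            unfolding 0
            subgoal using * by simp
            subgoal using * by simp
            subgoal using rs one by simp
            subgoal using *(1) take by simp
            done
        qed
        done
    qed
    subgoal premises prems for t s'
    proof -
      from prems obtain es q where *: "t \<le> 50 * (length ?ds + sum_list ?ds)"
        "length es = length ?ds" "layout ?ds b (es @ q) s'" "es = edge_sequence ?ds"
        and rs: "regs s' r_i = real (length ?ds)"
        unfolding I_def by auto
      show ?thesis
        apply (intro conjI)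
        subgoal using rs *(3) by (simp add: layout_def)
        apply (rule wp_intros)+
        apply (rule Q)
        subgoal using * prems1(1) by simp
        subgoal
          using *(3) unfolding *(4)[symmetric] stores_edges_def
          apply (intro conjI exI[of _ "b + length ?ds"])
          using *(2) by (auto simp: layout_def nth_append)
        done
    qed
    subgoal
      unfolding I_def using prems1
      apply simp
      apply (rule conjI)
      apply (simp add: layout_def)
      apply (rule exI[of _ "[(d, 0)]"])
      apply (intro exI[of _ "face_path 0 d d 1"] exI[of _ "Suc d"] conjI)
      apply (auto simp: layout_def)
      done
    subgoal by simp
    done
  done
qed

section \<open>Plane trees and dissections\<close>

fun no_unary :: "plane_tree \<Rightarrow> bool" where
  "no_unary (Branch ts) \<longleftrightarrow> length ts \<noteq> 1 \<and> (\<forall>t\<in>set ts. no_unary t)"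

abbreviation forest_leaves :: "plane_tree list \<Rightarrow> nat" where
  "forest_leaves ts \<equiv> sum_list (map num_leaves ts)"

text \<open>Preorder listing, where \<open>a\<close> is the gap to the left of the first leaf.
  Leaves yield unit segments, so with \<open>a = 0\<close> they become the polygon sides other than
  the root side.\<close>

function segs :: "nat \<Rightarrow> plane_tree \<Rightarrow> (nat \<times> nat) list"
  and forest_segs :: "nat \<Rightarrow> plane_tree list \<Rightarrow> (nat \<times> nat) list" where
  "segs a (Branch ts) = (a, a + num_leaves (Branch ts)) # forest_segs a ts"
| "forest_segs a [] = []"
| "forest_segs a (t # ts) = segs a t @ forest_segs (a + num_leaves t) ts"
  by pat_completeness auto
termination
  by (relation "Wellfounded.measure (case_sum (\<lambda>(a, t). size t) (\<lambda>(a, ts). size_list size ts))") auto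

lemma num_leaves_pos: "num_leaves t > 0"
proof (induction t)
  case (Branch ts)
  then show ?case by (cases ts) auto
qed

lemma length_le_forest_leaves: "length ts \<le> forest_leaves ts"
proof (induction ts)
  case (Cons t ts)
  then show ?case using num_leaves_pos[of t] by simp
qed simp

lemma forest_leaves_pos: "ts \<noteq> [] \<Longrightarrow> 0 < forest_leaves ts"
  using length_le_forest_leaves[of ts] length_greater_0_conv[of ts] by linarith

lemma segs_bounds:
  "e \<in> set (segs a t) \<Longrightarrow> a \<le> fst e \<and> fst e < snd e \<and> snd e \<le> a + num_leaves t"
  "e \<in> set (forest_segs a ts) \<Longrightarrow> a \<le> fst e \<and> fst e < snd e \<and> snd e \<le> a + forest_leaves ts"
proof (induction a t and a ts arbitrary: e and e rule: segs_forest_segs.induct)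
  case (1 a ts)
  show ?case
  proof (cases "ts = []")
    case False
    from 1 False show ?thesis
      using "1.IH"[of e] forest_leaves_pos[OF False] by (cases "e = (a, a + forest_leaves ts)") simp_all
  qed (use 1 in auto)
next
  case (3 a t ts)
  then show ?case by fastforce
qed auto

lemma root_in_segs: "(a, a + num_leaves t) \<in> set (segs a t)"
  by (cases t) simp

lemma unit_in_segs:
  "a \<le> k \<Longrightarrow> k < a + num_leaves t \<Longrightarrow> (k, Suc k) \<in> set (segs a t)"
  "a \<le> k \<Longrightarrow> k < a + forest_leaves ts \<Longrightarrow> (k, Suc k) \<in> set (forest_segs a ts)"
proof (induction a t and a ts rule: segs_forest_segs.induct)
  case (1 a ts)
  then show ?case by (cases "ts = []") (auto split: if_splits)
next
  case (3 a t ts)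
  then show ?case by (cases "k < a + num_leaves t") auto
qed auto

definition noncrossing :: "(nat \<times> nat) set \<Rightarrow> bool" where
  "noncrossing F \<longleftrightarrow> (\<forall>e\<in>F. \<forall>f\<in>F. \<not> crossing e f)"

text \<open>The segments of a vertex and a descendant are nested; those of sibling subtrees lie in
  intervals that share at most an endpoint.\<close>

lemma segs_noncrossing:
  "noncrossing (set (segs a t))" "noncrossing (set (forest_segs a ts))"
proof (induction a t and a ts rule: segs_forest_segs.induct)
  case (1 a ts)
  have "\<not> crossing (a, a + num_leaves (Branch ts)) f \<and> \<not> crossing f (a, a + num_leaves (Branch ts))"
    if "f \<in> set (forest_segs a ts)" for f
    using segs_bounds(2)[OF that] by (auto simp: crossing_def split: if_splits)
  with 1 show ?case by (auto simp: noncrossing_def crossing_def)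
next
  case (3 a t ts)
  have "\<not> crossing e f \<and> \<not> crossing f e"
    if "e \<in> set (segs a t)" "f \<in> set (forest_segs (a + num_leaves t) ts)" for e f
    using segs_bounds(1)[OF that(1)] segs_bounds(2)[OF that(2)] by (auto simp: crossing_def)
  with 3 show ?case by (auto simp: noncrossing_def)
qed (auto simp: noncrossing_def)

text \<open>Every tree has a leaf, so each of two or more trees covers only a proper part of the
  interval. This is where unary vertices are excluded: such a vertex would share its segment with
  its child.\<close>

lemma whole_notin_forest_segs:
  assumes "length ts \<noteq> 1" shows "(a, a + forest_leaves ts) \<notin> set (forest_segs a ts)"
proof (cases ts)
  case (Cons t ts')
  with assms have ts': "ts' \<noteq> []" by auto
  show ?thesis
    using segs_bounds(1)[of "(a, a + forest_leaves ts)" a t]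
      segs_bounds(2)[of "(a, a + forest_leaves ts)" "a + num_leaves t" ts']
      forest_leaves_pos[OF ts'] num_leaves_pos[of t] Cons by (auto simp del: sum_list_eq_0_iff)
qed simp

lemma distinct_segs:
  "no_unary t \<Longrightarrow> distinct (segs a t)" "\<forall>t\<in>set ts. no_unary t \<Longrightarrow> distinct (forest_segs a ts)"
proof (induction a t and a ts rule: segs_forest_segs.induct)
  case (1 a ts)
  then show ?case
    using whole_notin_forest_segs[of ts a] by (cases "ts = []") auto
next
  case (3 a t ts)
  have "e \<notin> set (forest_segs (a + num_leaves t) ts)" if "e \<in> set (segs a t)" for e
    using segs_bounds(1)[OF that] segs_bounds(2)[of e "a + num_leaves t" ts] by linarith
  with 3 show ?case by auto
qed auto

text \<open>The root of the first tree has the longest segment starting at \<open>a\<close>, and no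
  segment reaches across its right end. So the set alone tells where the first tree stops.\<close>

lemma forest_segs_first:
  "(a, y) \<in> set (forest_segs a (t # ts)) \<Longrightarrow> y \<le> a + num_leaves t"
  "set (segs a t) = {e \<in> set (forest_segs a (t # ts)). snd e \<le> a + num_leaves t}"
  "set (forest_segs (a + num_leaves t) ts) = {e \<in> set (forest_segs a (t # ts)). a + num_leaves t \<le> fst e}"
proof -
  have L: "a \<le> fst e \<and> fst e < snd e \<and> snd e \<le> a + num_leaves t" if "e \<in> set (segs a t)" for e
    using segs_bounds(1)[OF that] .
  have R: "a + num_leaves t \<le> fst e \<and> fst e < snd e" if "e \<in> set (forest_segs (a + num_leaves t) ts)" for e
    using segs_bounds(2)[OF that] by simp
  show "(a, y) \<in> set (forest_segs a (t # ts)) \<Longrightarrow> y \<le> a + num_leaves t"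
    using L[of "(a, y)"] R[of "(a, y)"] num_leaves_pos[of t] by auto
  show "set (segs a t) = {e \<in> set (forest_segs a (t # ts)). snd e \<le> a + num_leaves t}"
    using L R by (auto; fastforce)
  show "set (forest_segs (a + num_leaves t) ts) = {e \<in> set (forest_segs a (t # ts)). a + num_leaves t \<le> fst e}"
    using L R by (auto; fastforce)
qed

text \<open>A tree is decoded by deleting its root segment, which no descendant repeats; a forest is
  cut behind its first tree by \<open>forest_segs_first\<close>.\<close>

lemma segs_inj:
  "no_unary t \<Longrightarrow> no_unary t' \<Longrightarrow> num_leaves t = num_leaves t' \<Longrightarrow> set (segs a t) = set (segs a t') \<Longrightarrow> t = t'"
  "\<forall>t\<in>set ts. no_unary t \<Longrightarrow> \<forall>t\<in>set ts'. no_unary t \<Longrightarrow> set (forest_segs a ts) = set (forest_segs a ts') \<Longrightarrow> ts = ts'"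
proof (induction a t and a ts arbitrary: t' and ts' rule: segs_forest_segs.induct)
  case (1 a ts)
  obtain ts' where t': "t' = Branch ts'" by (cases t')
  have *: "length us \<noteq> 1 \<Longrightarrow> set (forest_segs a us) =
      set (segs a (Branch us)) - {(a, a + num_leaves (Branch us))}" for us
    using whole_notin_forest_segs[of us a] by (cases "us = []") auto
  have "set (forest_segs a ts) = set (forest_segs a ts')"
    using *[of ts] *[of ts'] "1.prems" t' by (simp del: segs.simps)
  then show ?case using 1 t' by simp
next
  case (2 a)
  then show ?case
    by (cases ts') (use root_in_segs in fastforce)+
next
  case (3 a t ts)
  obtain t' us where ts': "ts' = t' # us"
    using 3(5) root_in_segs[of a t] by (cases ts') auto
  have eq: "set (forest_segs a (t # ts)) = set (forest_segs a (t' # us))"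
    using 3(5) ts' by simp
  have "a + num_leaves t' \<le> a + num_leaves t"
  proof (rule forest_segs_first(1))
    show "(a, a + num_leaves t') \<in> set (forest_segs a (t # ts))"
      unfolding eq using root_in_segs[of a t'] by simp
  qed
  moreover have "a + num_leaves t \<le> a + num_leaves t'"
  proof (rule forest_segs_first(1))
    show "(a, a + num_leaves t) \<in> set (forest_segs a (t' # us))"
      unfolding eq[symmetric] using root_in_segs[of a t] by simp
  qed
  ultimately have leaves: "num_leaves t = num_leaves t'" by simp
  then have "set (segs a t) = set (segs a t')"
    unfolding forest_segs_first(2)[of a t ts] forest_segs_first(2)[of a t' us] eq by simp
  moreover have "set (forest_segs (a + num_leaves t) ts) = set (forest_segs (a + num_leaves t) us)"
    unfolding forest_segs_first(3)[of a t ts] unfolding leaves forest_segs_first(3)[of a t' us] eq by simp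
  ultimately show ?case
    using 3 ts' leaves by (metis list.set_intros(1) list.set_intros(2))
qed

text \<open>A dissection of the polygon with vertices \<open>a, ..., b\<close> whose root side
  \<open>(a, b)\<close> may be missing. These are the segment sets of forests, and unlike
  dissections they are stable under the recursion into subtrees.\<close>

definition subdivision :: "nat \<Rightarrow> nat \<Rightarrow> (nat \<times> nat) set \<Rightarrow> bool" where
  "subdivision a b F \<longleftrightarrow> F \<subseteq> {(x, y). a \<le> x \<and> x < y \<and> y \<le> b} \<and>
     (\<forall>k. a \<le> k \<and> k < b \<longrightarrow> (k, Suc k) \<in> F) \<and> noncrossing F"

lemma subdivision_restrict:
  assumes "subdivision a b F" "a \<le> a'" "b' \<le> b"
  shows "subdivision a' b' {e \<in> F. a' \<le> fst e \<and> snd e \<le> b'}"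
  using assms unfolding subdivision_def noncrossing_def by auto

lemma subdivision_forest:
  assumes "subdivision a b F" "a \<le> b"
  shows "\<exists>ts. (\<forall>t\<in>set ts. no_unary t) \<and> a + forest_leaves ts = b \<and> set (forest_segs a ts) = F"
  using assms
\<comment> \<open>Removing the root segment keeps the interval but lowers the indicator; splitting
  shortens the interval, and the factor 2 outweighs any gain of the indicator.\<close>
proof (induction "2 * (b - a) + (if (a, b) \<in> F then 1 else 0)" arbitrary: a b F rule: less_induct)
  case less
  have F: "F \<subseteq> {(x, y). a \<le> x \<and> x < y \<and> y \<le> b}" and units: "\<And>k. a \<le> k \<Longrightarrow> k < b \<Longrightarrow> (k, Suc k) \<in> F"
    and nc: "\<And>e f. e \<in> F \<Longrightarrow> f \<in> F \<Longrightarrow> \<not> crossing e f"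
    using less.prems(1) unfolding subdivision_def noncrossing_def by auto
  consider "a = b" | "b = Suc a" | "Suc a < b" "(a, b) \<in> F" | "Suc a < b" "(a, b) \<notin> F"
    using less.prems(2) by linarith
  then show ?case
  proof cases
    case 1
    then show ?thesis using F by (intro exI[of _ "[]"]) auto
  next
    case 2
    then have "F = {(a, Suc a)}" using F units[of a] by auto
    with 2 show ?thesis by (intro exI[of _ "[Branch []]"]) auto
  next
    case 3
    have "subdivision a b (F - {(a, b)})"
      using less.prems(1) 3 unfolding subdivision_def noncrossing_def by auto
    from less.hyps[OF _ this] 3 obtain ts where ts:
      "\<forall>t\<in>set ts. no_unary t" "a + forest_leaves ts = b" "set (forest_segs a ts) = F - {(a, b)}"
      by auto
    have "ts \<noteq> []" using ts(2) 3 by auto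
    moreover have "length ts \<noteq> 1"
    proof
      assume "length ts = 1"
      then obtain t where "ts = [t]" by (cases ts) auto
      with ts root_in_segs[of a t] show False by auto
    qed
    ultimately show ?thesis
      using ts 3 by (intro exI[of _ "[Branch ts]"]) auto
  next
    case 4
    \<comment> \<open>The longest segment from \<open>a\<close> becomes the root of the first tree.
      A segment reaching across \<open>m\<close> would either start at \<open>a\<close> and be
      longer, or start later and cross \<open>(a, m)\<close>.\<close>
    define m where "m = Max {y. (a, y) \<in> F}"
    have fin: "finite {y. (a, y) \<in> F}"
      by (rule finite_subset[of _ "{..b}"]) (use F in auto)
    have "(a, Suc a) \<in> F" using units[of a] 4 by simp
    then have am: "(a, m) \<in> F" and max: "\<And>y. (a, y) \<in> F \<Longrightarrow> y \<le> m"
      using Max_in[OF fin] Max_ge[OF fin] unfolding m_def by auto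
    have m: "a < m" "m < b"
      using am F 4 by (auto simp: le_less)
    let ?L = "{e \<in> F. a \<le> fst e \<and> snd e \<le> m}" and ?R = "{e \<in> F. m \<le> fst e \<and> snd e \<le> b}"
    have split: "F = ?L \<union> ?R"
    proof -
      have "snd e \<le> m \<or> m \<le> fst e" if "e \<in> F" for e
        using nc[OF am that] max[of "snd e"] that F
        by (cases e) (force simp: crossing_def)
      then show ?thesis using F by auto
    qed
    have decr: "x < y \<Longrightarrow> 2 * x + (if P then 1 else 0) < 2 * y + (if Q then 1 else (0::nat))" for x y P Q
      by auto
    obtain ts where ts: "\<forall>t\<in>set ts. no_unary t" "a + forest_leaves ts = m" "set (forest_segs a ts) = ?L"
      using less.hyps[OF decr subdivision_restrict[OF less.prems(1), of a m]] m by force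
    obtain us where us: "\<forall>t\<in>set us. no_unary t" "m + forest_leaves us = b" "set (forest_segs m us) = ?R"
      using less.hyps[OF decr subdivision_restrict[OF less.prems(1), of m b]] m by force
    \<comment> \<open>The left part contains its own whole interval, so its forest is a single
      tree.\<close>
    have "(a, m) \<in> set (forest_segs a ts)" unfolding ts(3) using am by simp
    then have "length ts = 1" using whole_notin_forest_segs[of ts a] ts(2) by blast
    then obtain t where "ts = [t]" by (cases ts) auto
    with ts us split show ?thesis by (intro exI[of _ "t # us"]) auto
  qed
qed

section \<open>Dissections as segment sets of trees\<close>

lemma noncrossing_sides:
  assumes "e \<in> polygon_sides n" "fst f < snd f" "snd f \<le> n"
  shows "\<not> crossing e f" "\<not> crossing f e"
  using assms by (auto simp: polygon_sides_def crossing_def)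

text \<open>The definition forbids crossings only among diagonals; a side crosses nothing, since all
  other vertices lie on the same side of it.\<close>

lemma dissections_iff:
  assumes "n > 0"
  shows "D \<in> dissections n \<longleftrightarrow> subdivision 0 n D \<and> (0, n) \<in> D"
proof
  assume "D \<in> dissections n"
  then obtain S where D: "D = polygon_sides n \<union> S" "S \<subseteq> polygon_diagonals n"
      and nc: "\<forall>e\<in>S. \<forall>f\<in>S. \<not> crossing e f"
    by (auto simp: dissections_def)
  have sub: "D \<subseteq> {(x, y). 0 \<le> x \<and> x < y \<and> y \<le> n}"
    using D assms by (auto simp: polygon_sides_def polygon_diagonals_def)
  moreover have "noncrossing D"
    unfolding noncrossing_def
  proof (intro ballI)
    fix e f assume ef: "e \<in> D" "f \<in> D"
    then have "fst e < snd e" "snd e \<le> n" "fst f < snd f" "snd f \<le> n"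
      using sub by auto
    then show "\<not> crossing e f"
      using ef nc noncrossing_sides[of e n f] noncrossing_sides[of f n e] D(1) by (metis Un_iff)
  qed
  ultimately show "subdivision 0 n D \<and> (0, n) \<in> D"
    using D(1) by (auto simp: subdivision_def polygon_sides_def)
next
  assume *: "subdivision 0 n D \<and> (0, n) \<in> D"
  then have "D = polygon_sides n \<union> (D - polygon_sides n)" "D - polygon_sides n \<subseteq> polygon_diagonals n"
    by (auto simp: polygon_sides_def polygon_diagonals_def subdivision_def)
  moreover have "\<forall>e\<in>D - polygon_sides n. \<forall>f\<in>D - polygon_sides n. \<not> crossing e f"
    using * by (auto simp: subdivision_def noncrossing_def)
  ultimately show "D \<in> dissections n"
    unfolding dissections_def by blast
qed

lemma bij_betw_dissections:
  assumes "n > 0"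
  shows "bij_betw (\<lambda>t. set (segs 0 t)) {t. no_unary t \<and> num_leaves t = n} (dissections n)"
proof (intro bij_betw_imageI inj_onI equalityI subsetI)
  fix t t' assume "t \<in> {t. no_unary t \<and> num_leaves t = n}" "t' \<in> {t. no_unary t \<and> num_leaves t = n}"
    "set (segs 0 t) = set (segs 0 t')"
  then show "t = t'" using segs_inj(1)[of t t' 0] by simp
next
  fix D assume "D \<in> (\<lambda>t. set (segs 0 t)) ` {t. no_unary t \<and> num_leaves t = n}"
  then obtain t where t: "num_leaves t = n" "D = set (segs 0 t)" by auto
  have "D \<subseteq> {(x, y). 0 \<le> x \<and> x < y \<and> y \<le> n}"
    using segs_bounds(1)[of _ 0 t] t by auto
  then show "D \<in> dissections n"
    using assms t unit_in_segs(1)[of 0 _ t] segs_noncrossing(1)[of 0 t] root_in_segs[of 0 t]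
    by (simp add: dissections_iff subdivision_def)
next
  fix D assume D: "D \<in> dissections n"
  then obtain ts where ts: "\<forall>t\<in>set ts. no_unary t" "forest_leaves ts = n" "set (forest_segs 0 ts) = D"
    using subdivision_forest[of 0 n D] assms by (auto simp: dissections_iff)
  have "length ts = 1"
    using whole_notin_forest_segs[of ts 0] ts D assms by (auto simp: dissections_iff)
  then obtain t where "ts = [t]" by (cases ts) auto
  with ts show "D \<in> (\<lambda>t. set (segs 0 t)) ` {t. no_unary t \<and> num_leaves t = n}" by auto
qed

section \<open>The edge sequence of a tree\<close>

text \<open>In breadth-first order neighbours in the queue need not be neighbours in the plane, so
  each tree carries its own offset.\<close>

fun place :: "nat \<Rightarrow> plane_tree list \<Rightarrow> (nat \<times> plane_tree) list" where
  "place a [] = []"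
| "place a (t # ts) = (a, t) # place (a + num_leaves t) ts"

definition root_seg :: "nat \<times> plane_tree \<Rightarrow> nat \<times> nat" where
  "root_seg p = (fst p, fst p + num_leaves (snd p))"

lemma map_snd_place [simp]: "map snd (place a ts) = ts"
  by (induction a ts rule: place.induct) auto

lemma mset_forest_segs: "mset (forest_segs a ts) = (\<Sum>p\<leftarrow>place a ts. mset (segs (fst p) (snd p)))"
  by (induction a ts rule: place.induct) auto

lemma set_face_path: "set (face_path u w d v) \<subseteq> ({u, w} \<union> {v..<v + (d - 1)}) \<times> ({u, w} \<union> {v..<v + (d - 1)})"
proof (induction u w d v rule: face_path.induct)
  case (3 u w d v)
  then show ?case by fastforce
qed auto

text \<open>The new vertices are the gaps between consecutive children. A renaming that is right at
  the two ends therefore extends to them without touching any other name.\<close>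

lemma face_path_place:
  assumes "ts \<noteq> []" "r u = a" "r w = a + forest_leaves ts"
    and "u \<notin> {v..<v + (length ts - 1)}" "w \<notin> {v..<v + (length ts - 1)}"
  shows "\<exists>r'. (\<forall>k. k \<notin> {v..<v + (length ts - 1)} \<longrightarrow> r' k = r k) \<and>
    map (map_prod r' r') (face_path u w (length ts) v) = map root_seg (place a ts)"
  using assms
proof (induction u w "length ts" v arbitrary: ts a r rule: face_path.induct)
  case (1 u w v)
  then show ?case by simp
next
  case (2 u w v)
  then obtain t where "ts = [t]" by (cases ts) auto
  with 2 show ?case by (auto simp: root_seg_def)
next
  case (3 u w d v)
  obtain t t' ts' where ts: "ts = t # t' # ts'" and d: "d = length ts'"
    using 3(2) by (auto simp: length_Suc_conv eq_commute[of "Suc _"])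
  \<comment> \<open>The first new vertex is the gap behind the first child.\<close>
  define r1 where "r1 = r(v := a + num_leaves t)"
  have w: "w \<noteq> v" using 3(7) ts by auto
  have u: "u \<noteq> v" using 3(6) ts by auto
  have "\<exists>r'. (\<forall>k. k \<notin> {Suc v..<Suc v + (length (t' # ts') - 1)} \<longrightarrow> r' k = r1 k) \<and>
    map (map_prod r' r') (face_path v w (length (t' # ts')) (Suc v)) = map root_seg (place (a + num_leaves t) (t' # ts'))"
    by (rule 3(1)) (use 3(5,7) ts d w in \<open>auto simp: r1_def\<close>)
  then obtain r' where r': "\<forall>k. k \<notin> {Suc v..<Suc v + length ts'} \<longrightarrow> r' k = r1 k"
    "map (map_prod r' r') (face_path v w (Suc d) (Suc v)) = map root_seg (place (a + num_leaves t) (t' # ts'))"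
    using d by auto
  have "r' u = a" using r'(1)[rule_format, of u] 3(6,4) ts u by (auto simp: r1_def)
  moreover have "r' v = a + num_leaves t" using r'(1)[rule_format, of v] by (simp add: r1_def)
  moreover have "r' k = r k" if "k \<notin> {v..<v + (length ts - 1)}" for k
    using that r'(1)[rule_format, of k] ts by (cases "k = v") (auto simp: r1_def)
  ultimately show ?case
    using r'(2) ts d by (intro exI[of _ r']) (auto simp: root_seg_def)
qed

lemma length_glue_bfs:
  "length q = length ts \<Longrightarrow> length (glue (bfs_queue ts) q v) = length (bfs_queue ts)"
proof (induction ts arbitrary: q v rule: bfs_queue.induct)
  case (2 us ts)
  then obtain e q' where "q = e # q'" by (cases q) auto
  with 2 show ?case by (cases e) simp
qed simp

text \<open>The edge queue and the tree queue run in parallel, each pending edge being the root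
  segment of its tree up to \<open>r\<close>. The extension keeps the values below \<open>v\<close>,
  so edges created earlier retain their meaning. The bound \<open>v'\<close> counts the names used
  in the end.\<close>

lemma glue_segs:
  assumes "map (map_prod r r) q = map root_seg ps" "set q \<subseteq> {..<v} \<times> {..<v}"
    and "v' = v + (\<Sum>d\<leftarrow>bfs_queue (map snd ps). d - 1)"
  shows "\<exists>r'. (\<forall>k<v. r' k = r k) \<and>
    mset (map (map_prod r' r') (glue (bfs_queue (map snd ps)) q v)) = (\<Sum>p\<leftarrow>ps. mset (segs (fst p) (snd p))) \<and>
    set (glue (bfs_queue (map snd ps)) q v) \<subseteq> {..<v'} \<times> {..<v'}"
  using assms
proof (induction "map snd ps" arbitrary: ps q r v rule: bfs_queue.induct)
  case 1
  then show ?case by auto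
next
  case (2 ts qs)
  obtain a ps' where ps: "ps = (a, Branch ts) # ps'" "map snd ps' = qs"
    using 2(2) by (cases ps) auto
  obtain u w q' where q: "q = (u, w) # q'"
    using 2(3) ps by (cases q) auto
  define v1 where "v1 = v + (length ts - 1)"
  have uw: "u < v" "w < v" "r u = a" "r w = a + num_leaves (Branch ts)"
    and q': "set q' \<subseteq> {..<v} \<times> {..<v}" "map (map_prod r r) q' = map root_seg ps'"
    using 2(3,4) ps q by (auto simp: root_seg_def)
  obtain r1 where r1: "\<And>k. k < v \<Longrightarrow> r1 k = r k"
    "map (map_prod r1 r1) (face_path u w (length ts) v) = map root_seg (place a ts)"
  proof (cases "ts = []")
    case False
    have "\<exists>r'. (\<forall>k. k \<notin> {v..<v + (length ts - 1)} \<longrightarrow> r' k = r k) \<and>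
        map (map_prod r' r') (face_path u w (length ts) v) = map root_seg (place a ts)"
      by (rule face_path_place) (use False uw in auto)
    then obtain r1 where "\<forall>k. k \<notin> {v..<v + (length ts - 1)} \<longrightarrow> r1 k = r k"
      "map (map_prod r1 r1) (face_path u w (length ts) v) = map root_seg (place a ts)" by blast
    then show ?thesis by (intro that[of r1]) simp_all
  qed (use that in auto)
  have set1: "set (q' @ face_path u w (length ts) v) \<subseteq> {..<v1} \<times> {..<v1}"
    using q'(1) uw set_face_path[of u w "length ts" v] by (fastforce simp: v1_def)
  \<comment> \<open>Pending edges use only names below \<open>v\<close>, where the extension agrees
    with \<open>r\<close>.\<close>
  have "map (map_prod r1 r1) q' = map (map_prod r r) q'"
    using q'(1) r1(1) by (auto simp: map_prod_def)
  then have map1: "map (map_prod r1 r1) (q' @ face_path u w (length ts) v) = map root_seg (ps' @ place a ts)"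
    using r1(2) q'(2) by simp
  have snd1: "qs @ ts = map snd (ps' @ place a ts)" using ps by simp
  have v': "v' = v1 + (\<Sum>d\<leftarrow>bfs_queue (map snd (ps' @ place a ts)). d - 1)"
    using 2(5) ps by (simp add: v1_def)
  let ?rest = "glue (bfs_queue (qs @ ts)) (q' @ face_path u w (length ts) v) v1"
  have glue: "glue (bfs_queue (map snd ps)) q v = (u, w) # ?rest"
    using ps q by (simp add: v1_def)
  from 2(1)[OF snd1 map1 set1 v'] obtain r2 where r2: "\<And>k. k < v1 \<Longrightarrow> r2 k = r1 k"
    "mset (map (map_prod r2 r2) ?rest) = (\<Sum>p\<leftarrow>ps' @ place a ts. mset (segs (fst p) (snd p)))"
    "set ?rest \<subseteq> {..<v'} \<times> {..<v'}"
    unfolding snd1[symmetric] by auto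
  have "v \<le> v1" "v1 \<le> v'" using v' by (simp_all add: v1_def)
  then have "\<And>k. k < v \<Longrightarrow> r2 k = r k" using r1(1) r2(1) by simp
  moreover from this have "map_prod r2 r2 (u, w) = (a, a + num_leaves (Branch ts))"
    using uw by simp
  ultimately show ?case
    unfolding glue using r2(2,3) ps uw \<open>v \<le> v1\<close> \<open>v1 \<le> v'\<close>
    by (intro exI[of _ r2]) (auto simp: mset_forest_segs add_ac)
qed

text \<open>An inner vertex with \<open>d\<close> children turns one pending tree into
  \<open>d\<close>; a leaf contributes 0 by truncated subtraction.\<close>

lemma forest_leaves_bfs: "forest_leaves q = length q + (\<Sum>d\<leftarrow>bfs_queue q. d - 1)"
proof (induction q rule: bfs_queue.induct)
  case (2 ts q)
  then show ?case
    by (cases "ts = []") (auto simp flip: length_greater_0_conv)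
qed simp

text \<open>Every vertex outside the initial queue is the child of exactly one vertex.\<close>

lemma sum_list_bfs_queue: "sum_list (bfs_queue q) + length q = length (bfs_queue q)"
  by (induction q rule: bfs_queue.induct) auto

text \<open>Processing an inner vertex lowers the left side by 2 and its children, at least two,
  restore this. For a single tree the summand \<open>length q\<close> yields the bound
  \<open>2 * n - 1\<close>.\<close>

lemma length_bfs_queue_le:
  "\<forall>t\<in>set q. no_unary t \<Longrightarrow> length (bfs_queue q) + length q \<le> 2 * forest_leaves q"
proof (induction q rule: bfs_queue.induct)
  case (2 ts q)
  show ?case
  proof (cases ts)
    case (Cons t us)
    with 2 have "us \<noteq> []" by auto
    then obtain u us' where "us = u # us'" by (cases us) auto
    moreover have "length (bfs_queue (q @ ts)) + length (q @ ts) \<le> 2 * forest_leaves (q @ ts)"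
      using 2 by auto
    ultimately show ?thesis using Cons by simp
  qed (use 2 in auto)
qed simp

text \<open>The children stand at the end of the next queue, and the known length of the old queue
  tells where to cut.\<close>

lemma bfs_queue_inj: "length q = length q' \<Longrightarrow> bfs_queue q = bfs_queue q' \<Longrightarrow> q = q'"
proof (induction q arbitrary: q' rule: bfs_queue.induct)
  case (2 ts q)
  then obtain ts' q'' where q': "q' = Branch ts' # q''"
    by (metis length_Suc_conv list.size(4) plane_tree.exhaust Suc_eq_plus1)
  have "q @ ts = q'' @ ts'"
    by (rule 2(1)) (use 2(2,3) q' in auto)
  moreover have "length q = length q''" using 2(2) q' by simp
  ultimately show ?case using q' by simp
qed simp

lemma bfs_inj: "bfs t = bfs t' \<Longrightarrow> t = t'"
  using bfs_queue_inj[of "[t]" "[t']"] by (simp add: bfs_def)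

lemma length_edge_sequence_bfs: "length (edge_sequence (bfs t)) = length (bfs t)"
  by (cases t) (simp add: bfs_def length_glue_bfs)

lemma edge_sequence_segs:
  assumes "num_leaves t = n" "n \<ge> 2"
  shows "\<exists>r. map_prod r r (hd (edge_sequence (bfs t))) = (n, 0) \<and>
    mset (map (map_prod r r) (tl (edge_sequence (bfs t)))) = mset (tl (segs 0 t)) \<and>
    set (edge_sequence (bfs t)) \<subseteq> {..n} \<times> {..n}"
proof -
  obtain ts where t: "t = Branch ts" by (cases t)
  with assms have ts: "ts \<noteq> []" "forest_leaves ts = n" by (auto split: if_splits)
  let ?d = "length ts"
  have "0 < ?d" using ts by simp
  \<comment> \<open>The first edge \<open>(?d, 0)\<close> must become the root side from
    \<open>n\<close> to \<open>0\<close>.\<close>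
  define r0 :: "nat \<Rightarrow> nat" where "r0 = (\<lambda>_. 0)(?d := n)"
  obtain r1 where r1: "\<And>k. k \<notin> {1..<1 + (?d - 1)} \<Longrightarrow> r1 k = r0 k"
    "map (map_prod r1 r1) (face_path 0 ?d ?d 1) = map root_seg (place 0 ts)"
    using face_path_place[OF ts(1), of r0 0 0 ?d 1] ts \<open>0 < ?d\<close> by (auto simp: r0_def)
  have set1: "set (face_path 0 ?d ?d 1) \<subseteq> {..<Suc ?d} \<times> {..<Suc ?d}"
    using set_face_path[of 0 ?d ?d 1] by fastforce
  \<comment> \<open>The initial cycle uses \<open>Suc ?d\<close> names and each gluing adds
    \<open>d - 1\<close>: one name per polygon vertex in total.\<close>
  have v': "Suc n = Suc ?d + (\<Sum>d\<leftarrow>bfs_queue (map snd (place 0 ts)). d - 1)"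
    using forest_leaves_bfs[of ts] ts by simp
  obtain r2 where r2: "\<And>k. k < Suc ?d \<Longrightarrow> r2 k = r1 k"
    "mset (map (map_prod r2 r2) (glue (bfs_queue ts) (face_path 0 ?d ?d 1) (Suc ?d))) = mset (forest_segs 0 ts)"
    "set (glue (bfs_queue ts) (face_path 0 ?d ?d 1) (Suc ?d)) \<subseteq> {..<Suc n} \<times> {..<Suc n}"
    using glue_segs[OF r1(2) set1 v'] by (auto simp: mset_forest_segs)
  have es: "edge_sequence (bfs t) = (?d, 0) # glue (bfs_queue ts) (face_path 0 ?d ?d 1) (Suc ?d)"
    by (simp add: t bfs_def)
  have "map_prod r2 r2 (?d, 0) = (n, 0)"
    using r1(1)[of ?d] r1(1)[of 0] r2(1)[of ?d] r2(1)[of 0] \<open>0 < ?d\<close> by (auto simp: r0_def)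
  moreover have "?d \<le> n" using v' by simp
  ultimately show ?thesis
    using r2(2,3) es t by (intro exI[of _ r2]) (auto simp: lessThan_Suc_atMost)
qed

text \<open>Along the path that \<open>r\<close> numbers consecutively, \<open>r'\<close> must
  increase at every edge, so \<open>r\<close> is bounded by \<open>r'\<close>. Both have the same
  sum over the vertices, hence they agree.\<close>

lemma describes_dissection_unique:
  assumes 1: "describes_dissection es n D" and 2: "describes_dissection es n D'"
    and D: "subdivision 0 n D" "(0, n) \<in> D" and D': "subdivision 0 n D'" "(0, n) \<in> D'" and "n \<ge> 2"
  shows "D = D'"
proof -
  let ?V = "fst ` set es \<union> snd ` set es"
  obtain r where r: "bij_betw r ?V {0..n}" "map_prod r r ` set (tl es) = D - {(0, n)}"
    using 1 unfolding describes_dissection_def by auto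
  obtain r' where r': "bij_betw r' ?V {0..n}" "map_prod r' r' ` set (tl es) = D' - {(0, n)}"
    using 2 unfolding describes_dissection_def by auto
  have tl: "set (tl es) \<subseteq> set es" using 1 by (cases es) (auto simp: describes_dissection_def)
  have le: "k \<le> r' x" if "x \<in> ?V" "r x = k" for k x
    using that
  proof (induction k arbitrary: x)
    case (Suc k)
    have "Suc k \<le> n" using Suc.prems bij_betwE[OF r(1)] by (metis atLeastAtMost_iff)
    \<comment> \<open>Since \<open>n \<ge> 2\<close>, this side differs from \<open>(0, n)\<close>
      and so comes from an edge in the tail of the list.\<close>
    then have "(k, Suc k) \<in> D - {(0, n)}"
      using D(1) \<open>n \<ge> 2\<close> by (auto simp: subdivision_def)
    then obtain y z where yz: "(y, z) \<in> set (tl es)" "r y = k" "r z = Suc k"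
      unfolding r(2)[symmetric] by auto
    then have V: "y \<in> ?V" "z \<in> ?V" using tl by force+
    have "z = x"
      using bij_betw_imp_inj_on[OF r(1)] V(2) Suc.prems yz(3) by (metis inj_onD)
    moreover have "(r' y, r' z) \<in> D'" using r'(2) yz(1) by force
    then have "r' y < r' z" using D'(1) by (auto simp: subdivision_def)
    ultimately show ?case using Suc.IH[OF V(1) yz(2)] by simp
  qed simp
  have "(\<Sum>x\<in>?V. r x) = (\<Sum>x\<in>?V. r' x)"
    using sum.reindex_bij_betw[OF r(1), of "\<lambda>x. x"] sum.reindex_bij_betw[OF r'(1), of "\<lambda>x. x"] by simp
  then have eq: "r x = r' x" if "x \<in> ?V" for x
    by (rule sum_mono_inv[where I = ?V]) (use le that in simp_all)
  have "map_prod r r ` set (tl es) = map_prod r' r' ` set (tl es)"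
  proof (rule image_cong)
    fix e assume "e \<in> set (tl es)"
    then have "fst e \<in> ?V" "snd e \<in> ?V" using tl by auto
    then show "map_prod r r e = map_prod r' r' e" using eq by (simp add: map_prod_def split_beta)
  qed simp
  then have "D - {(0, n)} = D' - {(0, n)}" using r(2) r'(2) by simp
  with D(2) D'(2) show ?thesis by blast
qed

lemma describes_dissection_segs:
  assumes "no_unary t" "num_leaves t = n" "n \<ge> 2"
  shows "describes_dissection (edge_sequence (bfs t)) n (set (segs 0 t))"
proof -
  let ?es = "edge_sequence (bfs t)"
  let ?V = "fst ` set ?es \<union> snd ` set ?es"
  obtain ts where t: "t = Branch ts" by (cases t)
  with assms have ts: "ts \<noteq> []" "forest_leaves ts = n" "length ts \<noteq> 1" by (auto split: if_splits)
  have segs: "segs 0 t = (0, n) # forest_segs 0 ts" using ts t by simp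
  obtain d ds where "bfs t = d # ds" by (simp add: t bfs_def)
  then have ne: "?es \<noteq> []" by simp
  obtain r where r: "map_prod r r (hd ?es) = (n, 0)"
    "mset (map (map_prod r r) (tl ?es)) = mset (forest_segs 0 ts)" "set ?es \<subseteq> {..n} \<times> {..n}"
    using edge_sequence_segs[OF assms(2,3)] segs by auto
  have set_tl: "map_prod r r ` set (tl ?es) = set (forest_segs 0 ts)"
    using arg_cong[OF r(2), of set_mset] by simp
  have dist: "distinct (forest_segs 0 ts)" using distinct_segs(1)[OF assms(1), of 0] segs by simp
  \<comment> \<open>The root side is directed backwards, all other segments forwards.\<close>
  have "hd ?es \<notin> set (tl ?es)"
  proof
    assume "hd ?es \<in> set (tl ?es)"
    then have "(n, 0) \<in> set (forest_segs 0 ts)" using set_tl r(1) by force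
    then show False using segs_bounds(2)[of "(n, 0)" 0 ts] by simp
  qed
  moreover have "distinct (tl ?es)"
    using dist mset_eq_imp_distinct_iff[OF r(2)] by (simp add: distinct_map)
  ultimately have distinct: "distinct ?es" using ne by (cases ?es) auto
  \<comment> \<open>Left ends of leaf segments give all positions but \<open>n\<close>, which the
    root side supplies. At most \<open>n + 1\<close> names occur, so surjectivity already gives a
    bijection by counting.\<close>
  have sub: "{0..n} \<subseteq> r ` ?V"
  proof
    fix k assume "k \<in> {0..n}"
    show "k \<in> r ` ?V"
    proof (cases "k = n")
      case True
      then have "k = r (fst (hd ?es))" using r(1) by (cases "hd ?es") simp
      with ne show ?thesis by force
    next
      case False
      then have "(k, Suc k) \<in> set (forest_segs 0 ts)"
        using unit_in_segs(2)[of 0 k ts] ts \<open>k \<in> {0..n}\<close> by simp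
      then obtain e where "e \<in> set (tl ?es)" "r (fst e) = k" unfolding set_tl[symmetric] by force
      then show ?thesis using list.set_sel(2)[OF ne] by blast
    qed
  qed
  have V: "?V \<subseteq> {0..n}" using r(3) by fastforce
  have fin: "finite ?V" by simp
  have card: "card {0..n} \<le> card (r ` ?V)" "card (r ` ?V) \<le> card ?V" "card ?V \<le> card {0..n}"
    using card_mono[OF finite_imageI[OF fin] sub] card_image_le[OF fin] card_mono[OF _ V] by blast+
  have "r ` ?V = {0..n}"
    using card_seteq[OF finite_imageI[OF fin] sub le_trans[OF card(2,3)]] by simp
  moreover have "inj_on r ?V"
    using eq_card_imp_inj_on[OF fin le_antisym[OF card(2) le_trans[OF card(3,1)]]] .
  ultimately have bij: "bij_betw r ?V {0..n}" by (simp add: bij_betw_def)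
  have "(0, n) \<notin> set (forest_segs 0 ts)"
    using whole_notin_forest_segs[OF ts(3), of 0] ts(2) by simp
  then show ?thesis
    unfolding describes_dissection_def using ne distinct bij r(1) set_tl segs by auto
qed

lemma describes_dissection_iff:
  assumes "no_unary t" "num_leaves t = n" "n \<ge> 2" "D \<in> dissections n"
  shows "describes_dissection (edge_sequence (bfs t)) n D \<longleftrightarrow> D = set (segs 0 t)"
proof -
  have "set (segs 0 t) \<in> dissections n"
    using bij_betwE[OF bij_betw_dissections[of n]] assms by auto
  then have "subdivision 0 n (set (segs 0 t))" "(0, n) \<in> set (segs 0 t)"
    "subdivision 0 n D" "(0, n) \<in> D"
    using assms dissections_iff[of n] by simp_all
  then show ?thesis
    using describes_dissection_segs[OF assms(1-3)] describes_dissection_unique[OF _ _ _ _ _ _ assms(3)]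
    by blast
qed

section \<open>Runs as random variables\<close>

text \<open>
  Measurability has to be proved for the events about the composed program: \<open>measure\<close> is \<open>0\<close> on
  nonmeasurable sets, and the assumption on the tree sampler only speaks about the tree events.
\<close>

instance arith_op :: countable by countable_datatype
instance com :: countable by countable_datatype

lemma prob_space_uniforms: "prob_space uniforms"
  unfolding uniforms_def by (intro prob_space_PiM prob_space_uniform_measure) auto

lemma space_uniforms [simp]: "space uniforms = UNIV"
  by (simp add: uniforms_def space_PiM)

lemma measurable_uniforms_component [measurable]: "(\<lambda>\<omega>. \<omega> i) \<in> borel_measurable uniforms"
proof -
  have "(\<lambda>\<omega>. \<omega> i) \<in> measurable uniforms (uniform_measure lborel {0..1})"
    unfolding uniforms_def by (rule measurable_component_singleton) simp
  then show ?thesis by (simp cong: measurable_cong_sets)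
qed

text \<open>Measurability is asked of each cell, which avoids choosing a sigma-algebra on
  states.\<close>

definition random_state :: "((nat \<Rightarrow> real) \<Rightarrow> ram_state) \<Rightarrow> bool" where
  "random_state f \<longleftrightarrow> (\<forall>i. (\<lambda>\<omega>. regs (f \<omega>) i) \<in> borel_measurable uniforms) \<and>
     (\<forall>i. (\<lambda>\<omega>. mem (f \<omega>) i) \<in> borel_measurable uniforms) \<and>
     (\<lambda>\<omega>. used (f \<omega>)) \<in> measurable uniforms (count_space UNIV)"

definition random_config :: "((nat \<Rightarrow> real) \<Rightarrow> com list \<times> ram_state) \<Rightarrow> bool" where
  "random_config f \<longleftrightarrow> (\<lambda>\<omega>. fst (f \<omega>)) \<in> measurable uniforms (count_space UNIV) \<and>
     random_state (\<lambda>\<omega>. snd (f \<omega>))"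

lemma measurable_address [measurable]: "address \<in> measurable borel (count_space UNIV)"
  unfolding address_def by measurable

lemma random_state_set_reg:
  assumes "random_state f" and [measurable]: "g \<in> borel_measurable uniforms"
  shows "random_state (\<lambda>\<omega>. set_reg i (g \<omega>) (f \<omega>))"
proof -
  have "(\<lambda>\<omega>. regs (set_reg i (g \<omega>) (f \<omega>)) k) \<in> borel_measurable uniforms" for k
    using assms by (cases "k = i") (simp_all add: random_state_def)
  with assms show ?thesis by (simp add: random_state_def set_reg_def)
qed

lemma random_config_step_command:
  assumes f: "random_state f"
  shows "random_config (\<lambda>\<omega>. step \<omega> (cs, f \<omega>))"
proof -
  have r [measurable]: "\<And>i. (\<lambda>\<omega>. regs (f \<omega>) i) \<in> borel_measurable uniforms"
    and m [measurable]: "\<And>i. (\<lambda>\<omega>. mem (f \<omega>) i) \<in> borel_measurable uniforms"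
    and u [measurable]: "(\<lambda>\<omega>. used (f \<omega>)) \<in> measurable uniforms (count_space UNIV)"
    using f by (auto simp: random_state_def)
  show ?thesis
  proof (cases cs)
    case Nil
    with f show ?thesis by (simp add: random_config_def)
  next
    case (Cons c cs')
    show ?thesis
    proof (cases c)
      case (Arith op i j k)
      have "(\<lambda>\<omega>. arith_val op (regs (f \<omega>) j) (regs (f \<omega>) k)) \<in> borel_measurable uniforms"
        by (cases op) simp_all
      then show ?thesis
        using Cons Arith f by (simp add: random_config_def random_state_set_reg)
    next
      case (Load i j)
      \<comment> \<open>The address is random but takes countably many values, each of which can be
        treated separately.\<close>
      have "(\<lambda>\<omega>. mem (f \<omega>) (address (regs (f \<omega>) j))) \<in> borel_measurable uniforms"
        by (rule measurable_compose_countable[where g = "\<lambda>\<omega>. address (regs (f \<omega>) j)"]) measurable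
      then show ?thesis
        using Cons Load f by (simp add: random_config_def random_state_set_reg)
    next
      case (Store i j)
      have "(\<lambda>\<omega>. if k = address (regs (f \<omega>) i) then regs (f \<omega>) j else mem (f \<omega>) k) \<in> borel_measurable uniforms" for k
        by measurable
      then show ?thesis
        using Cons Store f by (simp add: random_config_def random_state_def fun_upd_def)
    next
      case (Rand i)
      have "(\<lambda>\<omega>. \<omega> (used (f \<omega>))) \<in> borel_measurable uniforms"
        by (rule measurable_compose_countable[where f = "\<lambda>k \<omega>. \<omega> k"]) measurable
      moreover have "random_state (\<lambda>\<omega>. f \<omega>\<lparr>used := Suc (used (f \<omega>))\<rparr>)"
        using f unfolding random_state_def by auto
      ultimately show ?thesis
        using Cons Rand by (simp add: random_config_def random_state_set_reg)
    next
      case (IfLess i j a b)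
      have "(\<lambda>\<omega>. (if regs (f \<omega>) i < regs (f \<omega>) j then a else b) # cs') \<in> measurable uniforms (count_space UNIV)"
        by measurable
      then show ?thesis
        using Cons IfLess f by (simp add: random_config_def)
    next
      case (WhileLess i j a)
      have "(\<lambda>\<omega>. if regs (f \<omega>) i < regs (f \<omega>) j then a # WhileLess i j a # cs' else cs') \<in> measurable uniforms (count_space UNIV)"
        by measurable
      then show ?thesis
        using Cons WhileLess f by (simp add: random_config_def if_distrib[of fst] if_distrib[of snd] cong: if_cong)
    qed (use Cons f in \<open>simp_all add: random_config_def random_state_set_reg\<close>)
  qed
qed

lemma random_config_step:
  assumes "random_config f"
  shows "random_config (\<lambda>\<omega>. step \<omega> (f \<omega>))"
proof -
  have fst [measurable]: "(\<lambda>\<omega>. fst (f \<omega>)) \<in> measurable uniforms (count_space UNIV)"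
    and snd: "random_state (\<lambda>\<omega>. snd (f \<omega>))"
    using assms by (auto simp: random_config_def)
  \<comment> \<open>Stacks form a countable type, so measurability may be checked with the stack
    held fixed.\<close>
  have *: "(\<lambda>\<omega>. h (step \<omega> (f \<omega>))) \<in> measurable uniforms M"
    if "\<And>cs. (\<lambda>\<omega>. h (step \<omega> (cs, snd (f \<omega>)))) \<in> measurable uniforms M" for h :: "_ \<Rightarrow> 'a" and M
    using measurable_compose_countable[where f = "\<lambda>cs \<omega>. h (step \<omega> (cs, snd (f \<omega>)))", OF that fst] by simp
  note cmd = random_config_step_command[OF snd, unfolded random_config_def random_state_def]
  show ?thesis
    unfolding random_config_def random_state_def by (intro conjI allI *) (use cmd in auto)
qed

lemma random_config_run: "random_config (\<lambda>\<omega>. (step \<omega> ^^ t) (cs, s))"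
proof (induction t)
  case 0
  show ?case by (simp add: random_config_def random_state_def)
next
  case (Suc t)
  from random_config_step[OF this] show ?case by simp
qed

lemma measurable_run [measurable]:
  "(\<lambda>\<omega>. fst ((step \<omega> ^^ t) (cs, s))) \<in> measurable uniforms (count_space UNIV)"
  "(\<lambda>\<omega>. regs (snd ((step \<omega> ^^ t) (cs, s))) i) \<in> borel_measurable uniforms"
  "(\<lambda>\<omega>. mem (snd ((step \<omega> ^^ t) (cs, s))) i) \<in> borel_measurable uniforms"
  using random_config_run[of t cs s] by (auto simp: random_config_def random_state_def)

lemma returns_within_iff:
  "returns_within \<omega> p s t s' \<longleftrightarrow> fst ((step \<omega> ^^ t) ([p], s)) = [] \<and> s' = snd ((step \<omega> ^^ t) ([p], s))"
  by (auto simp: returns_within_def prod_eq_iff)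

lemma measurable_returns:
  assumes "\<And>t. (\<lambda>\<omega>. P (snd ((step \<omega> ^^ t) ([p], s)))) \<in> measurable uniforms (count_space UNIV)"
  shows "{\<omega>. \<exists>s'. returns \<omega> p s s' \<and> P s'} \<in> sets uniforms"
proof -
  note [measurable] = assms
  have "{\<omega> \<in> space uniforms. \<exists>t. fst ((step \<omega> ^^ t) ([p], s)) = [] \<and> P (snd ((step \<omega> ^^ t) ([p], s)))}
    \<in> sets uniforms" by measurable
  also have "{\<omega> \<in> space uniforms. \<exists>t. fst ((step \<omega> ^^ t) ([p], s)) = [] \<and> P (snd ((step \<omega> ^^ t) ([p], s)))}
    = {\<omega>. \<exists>s'. returns \<omega> p s s' \<and> P s'}"
    by (auto simp: returns_def returns_within_iff)
  finally show ?thesis .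
qed

lemma measurable_stores_list:
  "{\<omega>. \<exists>s'. returns \<omega> p s s' \<and> stores_list s' xs} \<in> sets uniforms"
  by (rule measurable_returns) (unfold stores_list_def, measurable)

lemma measurable_stores_edges:
  "{\<omega>. \<exists>s' es. returns \<omega> p s s' \<and> stores_edges s' es \<and> P es} \<in> sets uniforms"
proof -
  have "{\<omega>. \<exists>s'. returns \<omega> p s s' \<and> (\<exists>es. stores_edges s' es \<and> P es)} \<in> sets uniforms"
    by (rule measurable_returns) (unfold stores_edges_def, measurable)
  then show ?thesis by (simp add: ex_simps)
qed

lemma measurable_runtime [measurable]: "(\<lambda>\<omega>. runtime \<omega> p s) \<in> borel_measurable uniforms"
proof -
  \<comment> \<open>The infimum over a set depending on \<open>\<omega>\<close> becomes one over all
    \<open>t\<close>, which is countable and hence measurable.\<close>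
  have "runtime \<omega> p s = (INF t. if fst ((step \<omega> ^^ t) ([p], s)) = [] then of_nat t else \<infinity>)" for \<omega>
  proof (rule antisym)
    show "runtime \<omega> p s \<le> (INF t. if fst ((step \<omega> ^^ t) ([p], s)) = [] then of_nat t else \<infinity>)"
      unfolding runtime_def returns_within_iff by (intro INF_greatest) (auto intro: INF_lower)
    show "(INF t. if fst ((step \<omega> ^^ t) ([p], s)) = [] then of_nat t else \<infinity>) \<le> runtime \<omega> p s"
      unfolding runtime_def returns_within_iff
    proof (rule INF_greatest)
      fix t assume "t \<in> {t. \<exists>s'. fst ((step \<omega> ^^ t) ([p], s)) = [] \<and> s' = snd ((step \<omega> ^^ t) ([p], s))}"
      then show "(INF t. if fst ((step \<omega> ^^ t) ([p], s)) = [] then of_nat t else \<infinity>) \<le> (of_nat t :: ennreal)"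
        by (intro INF_lower2[of t]) auto
    qed
  qed
  moreover have "(\<lambda>\<omega>. INF t. if fst ((step \<omega> ^^ t) ([p], s)) = [] then of_nat t else (\<infinity>::ennreal))
      \<in> borel_measurable uniforms"
    by measurable
  ultimately show ?thesis by presburger
qed

section \<open>Sequential composition and running time\<close>

lemma step_append:
  "cs \<noteq> [] \<Longrightarrow> step \<omega> (cs @ ds, s) = (fst (step \<omega> (cs, s)) @ ds, snd (step \<omega> (cs, s)))"
  by (cases "(\<omega>, cs, s)" rule: step.cases) auto

text \<open>A halted configuration idles, whereas with \<open>ds\<close> beneath the machine would
  go on; hence \<open>t'\<close> can be smaller than \<open>t\<close>.\<close>

lemma run_append:
  "(step \<omega> ^^ t) (cs, s) = ([], s') \<Longrightarrow> \<exists>t'\<le>t. (step \<omega> ^^ t') (cs @ ds, s) = (ds, s')"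
proof (induction t arbitrary: cs s)
  case (Suc t)
  show ?case
  proof (cases "cs = []")
    case True
    have "(step \<omega> ^^ k) ([], s) = ([], s)" for k
      by (induction k) auto
    with Suc.prems True show ?thesis by (intro exI[of _ 0]) (auto simp del: funpow.simps)
  next
    case False
    obtain cs1 s1 where 1: "step \<omega> (cs, s) = (cs1, s1)" by fastforce
    with Suc.prems have "(step \<omega> ^^ t) (cs1, s1) = ([], s')"
      by (simp add: funpow_Suc_right del: funpow.simps)
    from Suc.IH[OF this] obtain t' where "t' \<le> t" "(step \<omega> ^^ t') (cs1 @ ds, s1) = (ds, s')" by blast
    then show ?thesis
      using step_append[OF False, of \<omega> ds s] 1
      by (intro exI[of _ "Suc t'"]) (simp add: funpow_Suc_right del: funpow.simps)
  qed
qed simp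

lemma returns_within_mono:
  assumes "returns_within \<omega> p s t s'" "t \<le> t'" shows "returns_within \<omega> p s t' s'"
proof -
  have "(step \<omega> ^^ k) ([], s') = ([], s')" for k
    by (induction k) auto
  moreover have "(step \<omega> ^^ t') ([p], s) = (step \<omega> ^^ (t' - t)) ((step \<omega> ^^ t) ([p], s))"
    using assms(2) by (simp flip: funpow_add[unfolded o_def, THEN fun_cong])
  ultimately show ?thesis
    using assms(1) unfolding returns_within_def by simp
qed

lemma returns_unique: "returns \<omega> p s s1 \<Longrightarrow> returns \<omega> p s s2 \<Longrightarrow> s1 = s2"
proof -
  assume "returns \<omega> p s s1" "returns \<omega> p s s2"
  then obtain t1 t2 where "returns_within \<omega> p s t1 s1" "returns_within \<omega> p s t2 s2"
    unfolding returns_def by blast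
  then have "returns_within \<omega> p s (max t1 t2) s1" "returns_within \<omega> p s (max t1 t2) s2"
    by (auto intro: returns_within_mono)
  then show "s1 = s2" by (simp add: returns_within_iff)
qed

lemma runtime_eq:
  assumes "returns_within \<omega> p s t s'"
  obtains t0 where "returns_within \<omega> p s t0 s'" "runtime \<omega> p s = of_nat t0"
proof -
  let ?T = "{t. \<exists>s'. returns_within \<omega> p s t s'}"
  define t0 where "t0 = (LEAST t. t \<in> ?T)"
  have "t \<in> ?T" using assms by blast
  then have t0: "t0 \<in> ?T" "\<And>k. k \<in> ?T \<Longrightarrow> t0 \<le> k"
    unfolding t0_def by (auto intro: LeastI Least_le)
  then obtain s0 where "returns_within \<omega> p s t0 s0" by blast
  moreover from this have "s0 = s'" using assms returns_unique unfolding returns_def by blast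
  moreover have "runtime \<omega> p s = of_nat t0"
    unfolding runtime_def
  proof (rule antisym)
    show "(INF t\<in>?T. of_nat t :: ennreal) \<le> of_nat t0"
      using t0(1) by (rule INF_lower)
    show "(of_nat t0 :: ennreal) \<le> (INF t\<in>?T. of_nat t)"
      using t0(2) by (intro INF_greatest) (simp only: of_nat_le_iff)
  qed
  ultimately show ?thesis using that by blast
qed

lemma runtime_le: "returns_within \<omega> p s t s' \<Longrightarrow> runtime \<omega> p s \<le> of_nat t"
  unfolding runtime_def by (rule INF_lower) blast

lemma returns_Seq:
  assumes "returns \<omega> a s s1" and "wp \<omega> b (\<lambda>t s'. t \<le> T \<and> Q s') s1"
  shows "\<exists>s2. returns \<omega> (a ;; b) s s2 \<and> Q s2 \<and> runtime \<omega> (a ;; b) s \<le> runtime \<omega> a s + of_nat (Suc T)"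
proof -
  obtain t s2 where t: "(step \<omega> ^^ t) ([b], s1) = ([], s2)" "t \<le> T" "Q s2"
    using assms(2) unfolding wp_def by blast
  obtain t0 where t0: "returns_within \<omega> a s t0 s1" "runtime \<omega> a s = of_nat t0"
    using assms(1) runtime_eq unfolding returns_def by metis
  obtain t1 where t1: "t1 \<le> t0" "(step \<omega> ^^ t1) ([a] @ [b], s) = ([b], s1)"
    using run_append t0(1) unfolding returns_within_def by blast
  have "(step \<omega> ^^ (t + t1 + 1)) ([a ;; b], s) = ([], s2)"
    using t1(2) t(1) by (simp only: funpow_add o_apply One_nat_def funpow.simps step.simps id_apply append.simps)
  then have "returns_within \<omega> (a ;; b) s (t + t1 + 1) s2" unfolding returns_within_def .
  then have within: "returns_within \<omega> (a ;; b) s (t0 + Suc T) s2"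
    by (rule returns_within_mono) (use t(2) t1(1) in simp)
  show ?thesis
  proof (intro exI[of _ s2] conjI)
    show "returns \<omega> (a ;; b) s s2" using within unfolding returns_def by blast
    show "runtime \<omega> (a ;; b) s \<le> runtime \<omega> a s + of_nat (Suc T)"
      using runtime_le[OF within] unfolding t0(2) of_nat_add .
  qed (fact t(3))
qed

section \<open>The offspring distribution\<close>

lemma pmf_zeta:
  assumes "0 < c" "c < 1 / 2"
  shows "pmf (zeta c) k = (if k = 0 then (1 - 2 * c) / (1 - c) else if k = 1 then 0 else c ^ (k - 1))"
proof -
  define f :: "nat \<Rightarrow> real" where
    "f = (\<lambda>k. if k = 0 then (1 - 2 * c) / (1 - c) else if k = 1 then 0 else c ^ (k - 1))"
  have nonneg: "0 \<le> f k" for k using assms by (simp add: f_def)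
  have "(\<lambda>k. c * c ^ k) sums (c * (1 / (1 - c)))"
    using assms by (intro sums_mult geometric_sums) simp
  then have "(\<lambda>k. f (Suc (Suc k))) sums (c / (1 - c))" by (simp add: f_def)
  from sums_Suc[OF sums_Suc[where f = "\<lambda>k. f (Suc k)", OF this]] have "f sums (c / (1 - c) + f 1 + f 0)" by simp
  also have "c / (1 - c) + f 1 + f 0 = 1" using assms by (simp add: f_def flip: add_divide_distrib)
  finally have "f sums 1" .
  then have "(\<Sum>k. ennreal (f k)) = ennreal 1"
    by (intro suminf_ennreal_eq nonneg)
  then have "(\<integral>\<^sup>+ k. ennreal (f k) \<partial>count_space UNIV) = 1"
    by (simp add: nn_integral_count_space_nat)
  then show ?thesis
    using pmf_embed_pmf[of f k] nonneg unfolding zeta_def f_def by simp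
qed

lemma integrable_nat_pmf_iff:
  fixes f :: "nat \<Rightarrow> real"
  shows "integrable (measure_pmf p) f \<longleftrightarrow> summable (\<lambda>k. \<bar>pmf p k * f k\<bar>)"
  unfolding measure_pmf_eq_density
  by (subst integrable_density) (auto simp: integrable_count_space_nat_iff)

lemma expectation_nat_pmf_sums:
  fixes f :: "nat \<Rightarrow> real"
  assumes "\<And>k. 0 \<le> f k" and "(\<lambda>k. pmf p k * f k) sums x"
  shows "measure_pmf.expectation p f = x"
proof -
  have "integrable (count_space UNIV) (\<lambda>k. pmf p k * f k)"
    using assms by (simp add: integrable_count_space_nat_iff sums_iff abs_mult)
  from sums_integral_count_space_nat[OF this] show ?thesis
    using assms(2) unfolding measure_pmf_eq_density
    by (subst integral_density) (auto dest: sums_unique2)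
qed

text \<open>The derivative of the geometric series, from which the missing value
  \<open>k = 1\<close> removes the term 1.\<close>

lemma expectation_zeta:
  assumes "0 < c" "c < 1 / 2"
  shows "measure_pmf.expectation (zeta c) real = 1 / (1 - c)\<^sup>2 - 1"
proof (rule expectation_nat_pmf_sums)
  let ?h = "\<lambda>k. pmf (zeta c) k * real k"
  have "(\<lambda>k. real (Suc k) * c ^ k) sums (1 / (1 - c)\<^sup>2)"
    using geometric_deriv_sums[of c] assms by simp
  then have "(\<lambda>k. real (Suc (Suc k)) * c ^ Suc k) sums (1 / (1 - c)\<^sup>2 - 1)"
    by (subst sums_Suc_iff) simp
  then have "(\<lambda>k. ?h (Suc (Suc k))) sums (1 / (1 - c)\<^sup>2 - 1)"
    using assms by (simp add: pmf_zeta mult.commute)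
  from sums_Suc[OF sums_Suc[where f = "\<lambda>k. ?h (Suc k)", OF this]]
  show "?h sums (1 / (1 - c)\<^sup>2 - 1)" using assms by (simp add: pmf_zeta)
qed simp

text \<open>Base 2 is admissible because \<open>2 * c < 1\<close> is the ratio of the resulting
  geometric series.\<close>

lemma exponential_moment_zeta:
  assumes "0 < c" "c < 1 / 2"
  shows "integrable (measure_pmf (zeta c)) (\<lambda>k. 2 ^ k :: real)"
  unfolding integrable_nat_pmf_iff
proof (rule iffD1[OF summable_iff_shift[of _ 2]])
  have "summable (\<lambda>k. 4 * c * (2 * c) ^ k)"
    using assms by (intro summable_mult summable_geometric) simp
  then show "summable (\<lambda>k. \<bar>pmf (zeta c) (k + 2) * 2 ^ (k + 2)\<bar>)"
    using assms by (simp add: pmf_zeta abs_mult power_mult_distrib mult_ac)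
qed

text \<open>The machine has only integer constants, so \<open>c\<close> is computed in register 3 as
  \<open>1 - sqrt (1 / 2)\<close>. At this parameter the probability of 0 simplifies to
  \<open>2 * c\<close>.\<close>

definition zeta_program :: com where
  "zeta_program =
     SetConst 1 1 ;; SetConst 2 2 ;; Arith Div 3 1 2 ;; Sqrt 3 3 ;; Arith Sub 3 1 3 ;;
     IfLess 0 1 (Arith Mul 0 2 3) (
       IfLess 1 0 (
         Move 4 1 ;; Move 5 1 ;;
         WhileLess 5 0 (Arith Mul 4 4 3 ;; Arith Add 5 5 1) ;;
         Move 0 4)
       (SetConst 0 0))"

lemma wp_zeta_program:
  assumes c: "c = 1 - sqrt (1 / 2)"
  shows "wp \<omega> zeta_program
    (\<lambda>t s. t \<le> 20 + 10 * k \<and>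
      regs s 0 = (if k = 0 then 2 * c else if k = 1 then 0 else c ^ (k - 1))) (input k)"
proof -
  define I where "I j t (s :: ram_state) \<longleftrightarrow> t + 10 \<le> 10 * j \<and> j > 0 \<and> regs s 0 = real k \<and> regs s 1 = 1 \<and> regs s 3 = c \<and>
    regs s 5 = real j \<and> regs s 4 = c ^ (j - 1)" for j t s
  show ?thesis
    unfolding zeta_program_def
    apply (rule wp_intros)+
    apply (rule wp_IfLess)
     apply (rule wp_intros)+
    subgoal by (simp add: input_def c)
    apply (rule wp_IfLess)
    subgoal
      apply (rule wp_intros)+
      apply (rule wp_WhileLess[where I = I and k = 1 and N = k])
      subgoal for j t s
        apply (rule conjI)
        subgoal by (simp add: I_def)
        apply (rule wp_intros)+
        apply (cases j)
         apply (simp_all add: I_def)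
        done
      subgoal
        apply (rule conjI)
        subgoal by (simp add: I_def)
        apply (rule wp_intros)+
        apply (auto simp: I_def input_def)
        done
      subgoal by (simp add: I_def input_def c)
      subgoal by (simp add: input_def)
      done
    subgoal
      apply (rule wp_intros)+
      apply (simp add: input_def)
      done
    done
qed

section \<open>The critical parameter\<close>

context
  fixes c :: real
  assumes c: "c = 1 - 2 powr (- 1 / 2)"
begin

lemma c_eq_sqrt: "c = 1 - sqrt (1 / 2)"
proof -
  have "2 powr (- 1 / 2) = inverse (2 powr (1 / 2) :: real)"
    by (simp flip: powr_minus)
  then show ?thesis by (simp add: c powr_half_sqrt real_sqrt_divide inverse_eq_divide)
qed

lemma c_square: "(1 - c)\<^sup>2 = 1 / 2"
  by (simp add: c_eq_sqrt)

lemma c_bounds: "0 < c" "c < 1 / 2"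
proof -
  have "1 / 2 < sqrt (1 / 2)" by (rule real_less_rsqrt) (simp add: power2_eq_square)
  then show "0 < c" "c < 1 / 2" by (simp_all add: c_eq_sqrt real_sqrt_lt_1_iff)
qed

text \<open>Clearing the denominator turns this into \<open>2 * (1 - c)\<^sup>2 = 1\<close>.\<close>

lemma pmf_zeta_0: "pmf (zeta c) 0 = 2 * c"
  using c_bounds c_square by (simp add: pmf_zeta field_simps power2_eq_square)

lemma subexp_computable_zeta: "subexp_computable (zeta c)"
  unfolding subexp_computable_def
\<comment> \<open>The exponential of this bound is \<open>30 * k\<close>, which dominates
  \<open>20 + 10 * k\<close> for \<open>k \<ge> 1\<close>. At \<open>k = 0\<close> the convention
  \<open>ln 0 = 0\<close> leaves 30.\<close>
proof (rule exI[of _ zeta_program], rule exI[of _ "\<lambda>k. ln 30 + ln (real k)"], intro conjI allI)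
  have "(\<lambda>k. ln 30 / real k + ln (real k) / real k) \<longlonglongrightarrow> 0 + 0"
    by (intro tendsto_add lim_const_over_n lim_ln_over_n)
  then show "(\<lambda>k. ln 30 + ln (real k)) \<in> o(\<lambda>k. real k)"
    using eventually_gt_at_top[of 0] by (intro smalloI_tendsto) (auto simp: add_divide_distrib elim: eventually_mono)
next
  fix \<omega> k
  obtain t s' where 1: "\<And>cs. (step \<omega> ^^ t) (zeta_program # cs, input k) = (cs, s')" and t: "t \<le> 20 + 10 * k"
    and s': "regs s' 0 = (if k = 0 then 2 * c else if k = 1 then 0 else c ^ (k - 1))"
    using wp_zeta_program[OF c_eq_sqrt, of \<omega> k] unfolding wp_def by blast
  have "real t \<le> exp (ln 30 + ln (real k))"
    using t by (cases "k = 0") (auto simp: exp_add)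
  moreover have "returns_within \<omega> zeta_program (input k) t s'"
    using 1 by (simp add: returns_within_def)
  moreover have "regs s' 0 = pmf (zeta c) k"
    using s' c_bounds pmf_zeta_0 by (simp add: pmf_zeta)
  ultimately show "\<exists>t s'. real t \<le> exp (ln 30 + ln (real k)) \<and>
      returns_within \<omega> zeta_program (input k) t s' \<and> regs s' 0 = pmf (zeta c) k"
    by blast
qed

lemma prob_zeta_ge_2: "0 < measure_pmf.prob (zeta c) {k. 2 \<le> k}"
proof -
  have "0 < measure_pmf.prob (zeta c) {2}"
    using c_bounds by (simp add: measure_pmf_single pmf_zeta)
  also have "\<dots> \<le> measure_pmf.prob (zeta c) {k. 2 \<le> k}"
    by (intro measure_pmf.finite_measure_mono) auto
  finally show ?thesis .
qed

text \<open>Here the constant originates: a mean of 1 amounts to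
  \<open>(1 - c)\<^sup>2 = 1 / 2\<close>.\<close>

lemma expectation_zeta_1: "measure_pmf.expectation (zeta c) real = 1"
  using expectation_zeta[OF c_bounds] by (simp add: c_square)

end

text \<open>The extra factor \<open>c\<close> makes the weight multiplicative: at an inner vertex
  with \<open>k\<close> children \<open>c * c ^ (k - 1) = c ^ k\<close> hands one factor to each
  child, so in the end only leaves contribute.\<close>

lemma bgw_zeta:
  assumes "0 < c" "c < 1 / 2"
  shows "c * bgw (zeta c) t = (if no_unary t then (c * pmf (zeta c) 0) ^ num_leaves t else 0)"
proof (induction t)
  case (Branch ts)
  have prod: "c ^ length us * prod_list (map (bgw (zeta c)) us) =
      (if \<forall>t\<in>set us. no_unary t then (c * pmf (zeta c) 0) ^ forest_leaves us else 0)"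
    if "set us \<subseteq> set ts" for us
    using that
  proof (induction us)
    case (Cons u us)
    have "c ^ length (u # us) * prod_list (map (bgw (zeta c)) (u # us)) =
        (c * bgw (zeta c) u) * (c ^ length us * prod_list (map (bgw (zeta c)) us))"
      by simp
    also have "\<dots> = (if no_unary u then (c * pmf (zeta c) 0) ^ num_leaves u else 0) *
        (if \<forall>t\<in>set us. no_unary t then (c * pmf (zeta c) 0) ^ forest_leaves us else 0)"
      using Cons Branch[of u] by simp
    finally show ?case by (simp add: power_add)
  qed simp
  consider "ts = []" | t where "ts = [t]" | "length ts \<ge> 2"
    by (cases ts rule: list.exhaust; cases "tl ts") (auto simp: Suc_le_eq)
  then show ?case
  proof cases
    case 3
    then have "c * pmf (zeta c) (length ts) = c ^ length ts"
      using assms by (auto simp: pmf_zeta simp flip: power_Suc)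
    then have "c * bgw (zeta c) (Branch ts) = c ^ length ts * prod_list (map (bgw (zeta c)) ts)"
      by simp
    then show ?thesis using prod[of ts] 3 by auto
  qed (use assms in \<open>auto simp: pmf_zeta\<close>)
qed

section \<open>The dissection sampler\<close>

definition reduced_trees :: "nat \<Rightarrow> plane_tree set" where
  "reduced_trees n = {t. no_unary t \<and> num_leaves t = n}"

lemma finite_dissections: "finite (dissections n)"
proof -
  have "finite (polygon_diagonals n)"
    by (rule finite_subset[of _ "{..n} \<times> {..n}"]) (auto simp: polygon_diagonals_def)
  moreover have "dissections n \<subseteq> (\<lambda>S. polygon_sides n \<union> S) ` Pow (polygon_diagonals n)"
    by (auto simp: dissections_def)
  ultimately show ?thesis by (metis finite_Pow_iff finite_imageI finite_subset)
qed

lemma dissections_nonempty: "dissections n \<noteq> {}"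
  by (auto simp: dissections_def)

lemma reduced_trees_dissections:
  assumes "n > 0"
  shows "finite (reduced_trees n)" "card (reduced_trees n) = card (dissections n)" "card (dissections n) > 0"
  using bij_betw_dissections[OF assms] finite_dissections[of n] dissections_nonempty[of n]
  by (auto simp: reduced_trees_def bij_betw_same_card card_gt_0_iff dest: bij_betw_finite)

context
  fixes c :: real
  assumes c: "0 < c" "c < 1 / 2"
begin

lemma bgw_zeta_reduced_trees:
  assumes "num_leaves t = n"
  shows "bgw (zeta c) t = (if t \<in> reduced_trees n then (c * pmf (zeta c) 0) ^ n / c else 0)"
  using bgw_zeta[OF c, of t] assms c by (auto simp: reduced_trees_def field_simps)

text \<open>Unary vertices admit infinitely many trees with \<open>n\<close> leaves, but those have
  weight 0 and the others are finite in number.\<close>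

lemma bgw_leaves_zeta:
  assumes "n > 0"
  shows "bgw_leaves (zeta c) n = real (card (dissections n)) * ((c * pmf (zeta c) 0) ^ n / c)"
proof -
  have "bgw_leaves (zeta c) n = infsum (\<lambda>_. (c * pmf (zeta c) 0) ^ n / c) (reduced_trees n)"
    unfolding bgw_leaves_def
    by (rule infsum_cong_neutral) (auto simp: bgw_zeta_reduced_trees reduced_trees_def)
  with reduced_trees_dissections[OF assms] show ?thesis by simp
qed

lemma bgw_leaves_zeta_pos:
  assumes "n > 0" shows "bgw_leaves (zeta c) n > 0"
  using reduced_trees_dissections(3)[OF assms] c unfolding bgw_leaves_zeta[OF assms]
  by (simp add: pmf_zeta)

lemma conditioned_bgw_uniform:
  assumes "t \<in> reduced_trees n" "n > 0"
  shows "bgw (zeta c) t / bgw_leaves (zeta c) n = 1 / real (card (dissections n))"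
proof -
  have "pmf (zeta c) 0 > 0" using c by (simp add: pmf_zeta)
  then show ?thesis
    using assms c bgw_zeta_reduced_trees[of t n]
    by (simp add: bgw_leaves_zeta reduced_trees_def)
qed

end

lemma stores_list_unique: "stores_list s xs \<Longrightarrow> stores_list s ys \<Longrightarrow> xs = ys"
  unfolding stores_list_def by (auto intro!: nth_equalityI)

lemma stores_edges_unique: "stores_edges s es \<Longrightarrow> stores_edges s fs \<Longrightarrow> es = fs"
  unfolding stores_edges_def by (auto intro!: nth_equalityI prod_eqI)

lemma wp_translate_bfs:
  assumes t: "t \<in> reduced_trees n" and s: "stores_list s (bfs t)"
  shows "wp \<omega> translate (\<lambda>k s'. k \<le> 400 * n \<and> stores_edges s' (edge_sequence (bfs t))) s"
proof -
  obtain d ds where bfs: "bfs t = d # ds"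
    by (cases t) (simp add: bfs_def)
  \<comment> \<open>Both bounds enter \<open>wp_translate\<close> with factor 100, which gives
    \<open>400 * n\<close>.\<close>
  have "length (bfs t) \<le> 2 * n" "sum_list (bfs t) \<le> 2 * n"
    using length_bfs_queue_le[of "[t]"] sum_list_bfs_queue[of "[t]"] t
    by (simp_all add: bfs_def reduced_trees_def)
  then show ?thesis
    using s length_edge_sequence_bfs[of t] unfolding bfs by (intro wp_translate) auto
qed

section \<open>From tree events to dissection events\<close>

context
  fixes n :: nat and A :: com and E :: "plane_tree \<Rightarrow> (nat \<Rightarrow> real) set"
  assumes n: "n \<ge> 2"
    and E_def: "\<And>t. E t = {\<omega>. \<exists>s. returns \<omega> A (input n) s \<and> stores_list s (bfs t)}"
    and prob_E: "\<And>t. t \<in> reduced_trees n \<Longrightarrow> measure uniforms (E t) = 1 / real (card (dissections n))"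
begin

interpretation prob_space uniforms by (rule prob_space_uniforms)

lemma E_measurable: "E t \<in> sets uniforms"
  unfolding E_def by (rule measurable_stores_list)

lemma E_disjoint:
  assumes "\<omega> \<in> E t" "\<omega> \<in> E t'" shows "t = t'"
  using assms returns_unique stores_list_unique bfs_inj unfolding E_def by blast

text \<open>The tree events are disjoint and their probabilities add up to 1. All other runs, in
  particular the nonterminating ones, thus form a null set.\<close>

lemma AE_E: "AE \<omega> in uniforms. \<exists>t\<in>reduced_trees n. \<omega> \<in> E t"
proof -
  have n0: "n > 0" using n by simp
  have "prob (\<Union>t\<in>reduced_trees n. E t) = (\<Sum>t\<in>reduced_trees n. prob (E t))"
    using reduced_trees_dissections(1)[OF n0] E_measurable E_disjoint
    by (intro finite_measure_finite_Union) (auto simp: disjoint_family_on_def)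
  also have "\<dots> = 1"
    using reduced_trees_dissections[OF n0] by (simp add: prob_E)
  finally have "AE \<omega> in uniforms. \<omega> \<in> (\<Union>t\<in>reduced_trees n. E t)"
    using E_measurable reduced_trees_dissections(1)[OF n0] by (subst prob_eq_1[symmetric]) auto
  then show ?thesis by simp
qed

lemma returns_translate:
  assumes "t \<in> reduced_trees n" "\<omega> \<in> E t"
  shows "\<exists>s. returns \<omega> (A ;; translate) (input n) s \<and> stores_edges s (edge_sequence (bfs t)) \<and>
    runtime \<omega> (A ;; translate) (input n) \<le> runtime \<omega> A (input n) + of_nat (Suc (400 * n))"
proof -
  obtain s where "returns \<omega> A (input n) s" "stores_list s (bfs t)"
    using assms(2) unfolding E_def by blast
  then show ?thesis by (intro returns_Seq wp_translate_bfs assms(1))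
qed

lemma expected_runtime_translate:
  "expected_runtime (A ;; translate) n \<le> expected_runtime A n + of_nat (Suc (400 * n))"
proof -
  have "expected_runtime (A ;; translate) n \<le>
      (\<integral>\<^sup>+ \<omega>. runtime \<omega> A (input n) + of_nat (Suc (400 * n)) \<partial>uniforms)"
    unfolding expected_runtime_def
    by (rule nn_integral_mono_AE) (use AE_E in eventually_elim, use returns_translate in blast)
  also have "\<dots> = expected_runtime A n + of_nat (Suc (400 * n))"
    unfolding expected_runtime_def using emeasure_space_1 by (subst nn_integral_add) auto
  finally show ?thesis .
qed

lemma prob_describes_dissection:
  assumes D: "D \<in> dissections n"
  shows "\<P>(\<omega> in uniforms. \<exists>s es. returns \<omega> (A ;; translate) (input n) s \<and> stores_edges s es \<and>
      describes_dissection es n D) = 1 / real (card (dissections n))"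
proof -
  let ?B = "{\<omega>. \<exists>s es. returns \<omega> (A ;; translate) (input n) s \<and> stores_edges s es \<and>
      describes_dissection es n D}"
  have bij: "bij_betw (\<lambda>t. set (segs 0 t)) (reduced_trees n) (dissections n)"
    using bij_betw_dissections[of n] n by (simp add: reduced_trees_def)
  then obtain t where t: "t \<in> reduced_trees n" "D = set (segs 0 t)"
    using D by (auto simp: bij_betw_def)
  \<comment> \<open>Almost every run outputs the edges of exactly one tree \<open>t'\<close>, and
    these describe \<open>D\<close> only if \<open>t' = t\<close>.\<close>
  have "AE \<omega> in uniforms. \<omega> \<in> ?B \<longleftrightarrow> \<omega> \<in> E t"
    using AE_E
  proof eventually_elim
    case (elim \<omega>)
    then obtain t' where t': "t' \<in> reduced_trees n" "\<omega> \<in> E t'" by blast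
    have "\<omega> \<in> ?B \<longleftrightarrow> describes_dissection (edge_sequence (bfs t')) n D"
      using returns_translate[OF t'] returns_unique stores_edges_unique by blast
    also have "\<dots> \<longleftrightarrow> set (segs 0 t) = set (segs 0 t')"
      using describes_dissection_iff[of t' n D] t' n D t(2) by (simp add: reduced_trees_def)
    also have "\<dots> \<longleftrightarrow> t = t'"
      using bij_betw_imp_inj_on[OF bij] t(1) t'(1) by (auto dest: inj_onD)
    also have "\<dots> \<longleftrightarrow> \<omega> \<in> E t" using t' E_disjoint by blast
    finally show ?case .
  qed
  then have "prob ?B = prob (E t)"
    using measurable_stores_edges E_measurable by (rule finite_measure_eq_AE)
  then show ?thesis using prob_E[OF t(1)] by simp
qed

end

theorem theorem5p13:
  fixes bgw_sampler :: "nat pmf \<Rightarrow> com" and c :: real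
  assumes bgw_sampler:
    "\<And>\<xi>. pmf \<xi> 0 > 0 \<Longrightarrow>
          measure_pmf.prob \<xi> {k. k \<ge> 2} > 0 \<Longrightarrow>
          measure_pmf.expectation \<xi> real = 1 \<Longrightarrow>
          (\<exists>\<epsilon>>0. integrable (measure_pmf \<xi>) (\<lambda>k. (1 + \<epsilon> :: real) ^ k)) \<Longrightarrow>
          subexp_computable \<xi> \<Longrightarrow>
          samples_conditioned_bgw \<xi> (bgw_sampler \<xi>) \<and>
          expected_linear_time_on {n. bgw_leaves \<xi> n > 0} (bgw_sampler \<xi>)"
    and c: "c = 1 - 2 powr (- 1 / 2)"
  shows "samples_uniform_dissection (dissection_sampler bgw_sampler c) \<and>
         expected_linear_time_on {n. n \<ge> 2} (dissection_sampler bgw_sampler c)"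
proof -
  note c_bounds = c_bounds[OF c]
  let ?A = "bgw_sampler (zeta c)"
  have "\<exists>\<epsilon>>0. integrable (measure_pmf (zeta c)) (\<lambda>k. (1 + \<epsilon> :: real) ^ k)"
    using exponential_moment_zeta[OF c_bounds] by (intro exI[of _ 1]) simp
  then have samples: "samples_conditioned_bgw (zeta c) ?A"
    and linear: "expected_linear_time_on {n. bgw_leaves (zeta c) n > 0} ?A"
    using bgw_sampler[of "zeta c"] pmf_zeta_0[OF c] c_bounds(1) prob_zeta_ge_2[OF c]
      expectation_zeta_1[OF c] subexp_computable_zeta[OF c] by auto
  have prob: "measure uniforms {\<omega>. \<exists>s. returns \<omega> ?A (input n) s \<and> stores_list s (bfs t)} =
      1 / real (card (dissections n))" if "n \<ge> 2" "t \<in> reduced_trees n" for n t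
  proof -
    have "bgw_leaves (zeta c) n > 0" using bgw_leaves_zeta_pos[OF c_bounds, of n] that(1) by simp
    then have "measure uniforms {\<omega>. \<exists>s. returns \<omega> ?A (input n) s \<and> stores_list s (bfs t)} =
        bgw (zeta c) t / bgw_leaves (zeta c) n"
      using samples that(2) by (auto simp: samples_conditioned_bgw_def reduced_trees_def)
    then show ?thesis using conditioned_bgw_uniform[OF c_bounds that(2)] that(1) by simp
  qed
  have "samples_uniform_dissection (dissection_sampler bgw_sampler c)"
    unfolding samples_uniform_dissection_def dissection_sampler_def
    using prob_describes_dissection[OF _ refl prob] by blast
  moreover have "expected_linear_time_on {n. n \<ge> 2} (dissection_sampler bgw_sampler c)"
  proof -
    let ?F = "inf sequentially (principal {n. n \<ge> 2})"
    let ?a = "\<lambda>n. expected_runtime ?A n" and ?b = "\<lambda>n. expected_runtime (?A ;; translate) n"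
    \<comment> \<open>The bound for the tree sampler concerns those \<open>n\<close> that occur as a
      number of leaves with positive probability; every \<open>n \<ge> 2\<close> does.\<close>
    have F: "?F \<le> inf sequentially (principal {n. bgw_leaves (zeta c) n > 0})"
      using bgw_leaves_zeta_pos[OF c_bounds] by (intro inf_mono) auto
    have fin: "\<forall>\<^sub>F n in ?F. ?a n < \<infinity>" and O: "(\<lambda>n. enn2real (?a n)) \<in> O[?F](\<lambda>n. real n)"
      using linear filter_leD[OF F] landau_o.big.filter_mono[OF F]
      unfolding expected_linear_time_on_def Let_def by auto
    have ge2: "\<forall>\<^sub>F n in ?F. n \<ge> 2" by (simp add: eventually_inf_principal)
    \<comment> \<open>\<open>enn2real\<close> maps infinity to 0, so finiteness is carried along
      with the bound.\<close>
    have le: "\<forall>\<^sub>F n in ?F. ?b n < \<infinity> \<and> enn2real (?b n) \<le> enn2real (?a n) + real (Suc (400 * n))"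
      using fin ge2
    proof eventually_elim
      case (elim n)
      have le: "?b n \<le> ?a n + of_nat (Suc (400 * n))"
        using expected_runtime_translate[OF _ refl prob] elim by blast
      have lt: "?a n + of_nat (Suc (400 * n)) < \<infinity>"
        using elim(1) of_nat_less_top[of "Suc (400 * n)"]
        by (simp only: ennreal_add_less_top infinity_ennreal_def)
      have "enn2real (?b n) \<le> enn2real (?a n + of_nat (Suc (400 * n)))"
        using le lt by (intro enn2real_mono) auto
      also have "\<dots> = enn2real (?a n) + real (Suc (400 * n))"
        using elim(1) of_nat_less_top[of "Suc (400 * n)"]
        by (simp only: enn2real_plus infinity_ennreal_def enn2real_of_nat)
      finally show ?case using le lt by (meson le_less_trans)
    qed
    \<comment> \<open>The constant 401 absorbs the successor, as \<open>n \<ge> 1\<close>.\<close>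
    have "(\<lambda>n. real (Suc (400 * n))) \<in> O[?F](\<lambda>n. real n)"
      by (rule bigoI[of _ 401]) (use ge2 in eventually_elim, simp)
    with O have "(\<lambda>n. enn2real (?a n) + real (Suc (400 * n))) \<in> O[?F](\<lambda>n. real n)"
      by (rule sum_in_bigo)
    moreover have "(\<lambda>n. enn2real (?b n)) \<in> O[?F](\<lambda>n. enn2real (?a n) + real (Suc (400 * n)))"
      by (rule bigoI[of _ 1]) (use le in eventually_elim, simp)
    ultimately have "(\<lambda>n. enn2real (?b n)) \<in> O[?F](\<lambda>n. real n)"
      by (rule landau_o.big_trans[rotated])
    with le show ?thesis
      unfolding expected_linear_time_on_def dissection_sampler_def Let_def
      by (auto elim: eventually_mono)
  qed
  ultimately show ?thesis ..
qed

end
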